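(* Let $V_i=[V_{i,1}\cdots V_{i,n_i}]$, $i\in\{1,\ldots,k\}$, be doubly $\Lambda$-commuting row isometries with $V_{i,m}\in B(\mathcal K)$. Then $\mathcal K$ admits a unique orthogonal decomposition $$\mathcal K=\bigoplus_{A\subset\{1,\ldots,k\}}\mathcal K_A$$ with the following properties: (i) for each subset $A\subset\{1,\ldots,k\}$, the subspace $\mathcal K_A$ is reducing for all the isometries $V_{i,m}$, $i\in\{1,\ldots,k\}$, $m\in\{1,\ldots,n_i\}$; (ii) if $i\in A$, then $V_i|_{\mathcal K_A}:=[V_{i,1}|_{\mathcal K_A}\cdots V_{i,n_i}|_{\mathcal K_A}]$ is a pure row isometry; (iii) if $i\in A^c$, then $V_i|_{\mathcal K_A}$ is a Cuntz row isometry. Moreover, $$\mathcal K_A=\Big(\bigcap_{i\in A}\mathcal K_i^{(s)}\Big)\cap\Big(\bigcap_{i\in A^c}\mathcal K_i^{(c)}\Big),$$ where $$\mathcal K_i^{(s)}:=\bigoplus_{\alpha\in\mathbb F_{n_i}^+}V_{i,\alpha}\Big(\bigcap_{m=1}^{n_i}\ker V_{i,m}^*\Big)\quad\text{and}\quad \mathcal K_i^{(c)}:=\bigcap_{p=0}^\infty\Big(\bigoplus_{\alpha\in\mathbb F_{n_i}^+,\,|\alpha|=p}V_{i,\alpha}\mathcal K\Big).$$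
   Context: Fix integers $k\ge1$, $n_1,\ldots,n_k\ge 1$ and, for $i\ne j$ in $\{1,\ldots,k\}$, an $n_i\times n_j$ matrix $\Lambda_{i,j}=[\lambda_{i,j}(s,t)]$ with entries in $\mathbb T=\{z\in\mathbb C:|z|=1\}$, such that $\Lambda_{j,i}=\Lambda_{i,j}^*$, i.e. $\lambda_{j,i}(t,s)=\overline{\lambda_{i,j}(s,t)}$. A row isometry $V_i=[V_{i,1}\cdots V_{i,n_i}]$ on a Hilbert space $\mathcal K$ consists of $V_{i,s}\in B(\mathcal K)$ with $V_{i,s}^*V_{i,t}=\delta_{st}I$. Row isometries $V_1,\ldots,V_k$ on $\mathcal K$ are doubly $\Lambda$-commuting if $V_{i,s}^*V_{j,t}=\overline{\lambda_{i,j}(s,t)}\,V_{j,t}V_{i,s}^*$ for all $i\neq j$, $s\in\{1,\ldots,n_i\}$, $t\in\{1,\ldots,n_j\}$. $\mathbb F_{n_i}^+$ is the unital free semigroup with generators $g_1^i,\ldots,g_{n_i}^i$ and neutral element $g_0^i$; $|\alpha|$ is word length; $V_{i,\alpha}:=V_{i,p_1}\cdots V_{i,p_m}$ for $\alpha=g^i_{p_1}\cdots g^i_{p_m}$ and $V_{i,g_0^i}:=I$. A row isometry $V_i$ on $\mathcal K$ is Cuntz if $\sum_{s=1}^{n_i}V_{i,s}V_{i,s}^*=I$; it is pure if there is a (closed) subspace $\mathcal L\subset\mathcal K$ with $\mathcal L\perp V_{i,\alpha}\mathcal L$ for all $|\alpha|\ge1$ and $\mathcal K=\bigoplus_{\alpha\in\mathbb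 F_{n_i}^+}V_{i,\alpha}\mathcal L$. Subspaces are closed and may be zero (on $\{0\}$ a row isometry counts as both pure and Cuntz). $A^c$ is the complement of $A$ in $\{1,\ldots,k\}$. *)

theory Defs
  imports "HOL-Analysis.Analysis"
begin

section \<open>Complex Hilbert spaces\<close>

class complex_vector = real_vector +
  fixes scaleC :: "complex \<Rightarrow> 'a \<Rightarrow> 'a"  (infixr "*\<^sub>C" 75)
  assumes scaleC_add_right: "c *\<^sub>C (x + y) = c *\<^sub>C x + c *\<^sub>C y"
    and scaleC_add_left: "(c + d) *\<^sub>C x = c *\<^sub>C x + d *\<^sub>C x"
    and scaleC_scaleC: "c *\<^sub>C d *\<^sub>C x = (c * d) *\<^sub>C x"
    and scaleC_of_real: "complex_of_real r *\<^sub>C x = r *\<^sub>R x"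

text \<open>The inner product is linear in the first and conjugate-linear in the second argument.\<close>

class complex_inner = complex_vector + real_normed_vector +
  fixes cinner :: "'a \<Rightarrow> 'a \<Rightarrow> complex"
  assumes cinner_commute: "cinner x y = cnj (cinner y x)"
    and cinner_add_left: "cinner (x + y) z = cinner x z + cinner y z"
    and cinner_scaleC_left: "cinner (c *\<^sub>C x) y = c * cinner x y"
    and cinner_self: "cinner x x = complex_of_real ((norm x)\<^sup>2)"

class chilbert_space = complex_inner + complete_space

instantiation complex :: chilbert_space
begin
definition scaleC_complex :: "complex \<Rightarrow> complex \<Rightarrow> complex"
  where "scaleC_complex c x = c * x"
definition cinner_complex :: "complex \<Rightarrow> complex \<Rightarrow> complex"
  where "cinner_complex x y = x * cnj y"
instance
proof
  fix x y z c d :: complex and r :: real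
  show "c *\<^sub>C (x + y) = c *\<^sub>C x + c *\<^sub>C y"
    by (simp add: scaleC_complex_def distrib_left)
  show "(c + d) *\<^sub>C x = c *\<^sub>C x + d *\<^sub>C x"
    by (simp add: scaleC_complex_def distrib_right)
  show "c *\<^sub>C d *\<^sub>C x = (c * d) *\<^sub>C x"
    by (simp add: scaleC_complex_def)
  show "complex_of_real r *\<^sub>C x = r *\<^sub>R x"
    by (simp add: scaleC_complex_def scaleR_conv_of_real)
  show "cinner x y = cnj (cinner y x)"
    by (simp add: cinner_complex_def)
  show "cinner (x + y) z = cinner x z + cinner y z"
    by (simp add: cinner_complex_def distrib_right)
  show "cinner (c *\<^sub>C x) y = c * cinner x y"
    by (simp add: cinner_complex_def scaleC_complex_def)
  show "cinner x x = complex_of_real ((norm x)\<^sup>2)"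
    unfolding cinner_complex_def by (rule complex_norm_square[symmetric])
qed
end

global_interpretation complex_vector: vector_space "scaleC :: complex \<Rightarrow> 'a \<Rightarrow> 'a::complex_vector"
  defines csubspace = complex_vector.subspace
    and cspan = complex_vector.span
proof
  show "1 *\<^sub>C x = x" for x :: 'a
    using scaleC_of_real[of 1 x] by simp
qed (simp_all add: scaleC_add_right scaleC_add_left scaleC_scaleC)

definition closed_csubspace :: "'a::complex_inner set \<Rightarrow> bool"
  where "closed_csubspace M \<longleftrightarrow> csubspace M \<and> closed M"

definition corthogonal :: "'a::complex_inner set \<Rightarrow> 'a set \<Rightarrow> bool"
  where "corthogonal S T \<longleftrightarrow> (\<forall>x\<in>S. \<forall>y\<in>T. cinner x y = 0)"

text \<open>The notation \<open>\<Oplus>\<^sub>i\<^sub>\<in>\<^sub>I F i\<close> presupposes \<open>orthogonal_summands I F\<close>;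
  the subspace it denotes is then \<open>osum I F\<close>.\<close>

definition orthogonal_summands :: "'i set \<Rightarrow> ('i \<Rightarrow> 'a::complex_inner set) \<Rightarrow> bool"
  where "orthogonal_summands I F \<longleftrightarrow>
    (\<forall>i\<in>I. closed_csubspace (F i)) \<and>
    (\<forall>i\<in>I. \<forall>j\<in>I. i \<noteq> j \<longrightarrow> corthogonal (F i) (F j))"

definition osum :: "'i set \<Rightarrow> ('i \<Rightarrow> 'a::complex_inner set) \<Rightarrow> 'a set"
  where "osum I F = closure (cspan (\<Union>i\<in>I. F i))"


section \<open>Operators on closed subspaces\<close>

text \<open>A closed subspace \<open>M\<close> is a Hilbert space in its own right, and an element of \<open>B(M)\<close> is
  represented by a function on the ambient space of which only the values on \<open>M\<close> matter.
  In this way the restriction of \<open>T\<close> to \<open>M\<close> is represented by \<open>T\<close> itself, considered on \<open>M\<close>.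
  The whole space is the case \<open>M = UNIV\<close>.\<close>

definition bounded_op_on :: "'a::complex_inner set \<Rightarrow> ('a \<Rightarrow> 'a) \<Rightarrow> bool"
  where "bounded_op_on M T \<longleftrightarrow>
    T ` M \<subseteq> M \<and>
    (\<forall>x\<in>M. \<forall>y\<in>M. T (x + y) = T x + T y) \<and>
    (\<forall>c. \<forall>x\<in>M. T (c *\<^sub>C x) = c *\<^sub>C T x) \<and>
    (\<exists>B. \<forall>x\<in>M. norm (T x) \<le> B * norm x)"

text \<open>The Hilbert space adjoint of \<open>T\<close> in \<open>B(M)\<close>; its values on \<open>M\<close> are determined uniquely.\<close>

definition adj_on :: "'a::chilbert_space set \<Rightarrow> ('a \<Rightarrow> 'a) \<Rightarrow> 'a \<Rightarrow> 'a"
  where "adj_on M T = (SOME S. bounded_op_on M S \<and>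
    (\<forall>x\<in>M. \<forall>y\<in>M. cinner (T x) y = cinner x (S y)))"

abbreviation adj :: "('a::chilbert_space \<Rightarrow> 'a) \<Rightarrow> 'a \<Rightarrow> 'a"
  where "adj \<equiv> adj_on UNIV"

definition reducing :: "'a::chilbert_space set \<Rightarrow> ('a \<Rightarrow> 'a) \<Rightarrow> bool"
  where "reducing M T \<longleftrightarrow> closed_csubspace M \<and> T ` M \<subseteq> M \<and> adj T ` M \<subseteq> M"


section \<open>Row isometries\<close>

text \<open>The row \<open>[W\<^sub>1 \<dots> W\<^sub>n]\<close> is given by the values \<open>W 1, \<dots>, W n\<close> of \<open>W\<close>.\<close>

definition row_isometry_on :: "'a::chilbert_space set \<Rightarrow> nat \<Rightarrow> (nat \<Rightarrow> 'a \<Rightarrow> 'a) \<Rightarrow> bool"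
  where "row_isometry_on M n W \<longleftrightarrow>
    closed_csubspace M \<and>
    (\<forall>s\<in>{1..n}. bounded_op_on M (W s)) \<and>
    (\<forall>s\<in>{1..n}. \<forall>t\<in>{1..n}. \<forall>x\<in>M. adj_on M (W s) (W t x) = (if s = t then x else 0))"

text \<open>Elements of the free semigroup on \<open>n\<close> generators are lists over \<open>{1..n}\<close>, the neutral
  element being the empty list.\<close>

abbreviation words :: "nat \<Rightarrow> nat list set"
  where "words n \<equiv> lists {1..n}"

primrec word_op :: "(nat \<Rightarrow> 'a \<Rightarrow> 'a) \<Rightarrow> nat list \<Rightarrow> 'a \<Rightarrow> 'a"
  where "word_op W [] = id"
  | "word_op W (p # w) = W p \<circ> word_op W w"

definition cuntz_on :: "'a::chilbert_space set \<Rightarrow> nat \<Rightarrow> (nat \<Rightarrow> 'a \<Rightarrow> 'a) \<Rightarrow> bool"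
  where "cuntz_on M n W \<longleftrightarrow>
    row_isometry_on M n W \<and> (\<forall>x\<in>M. (\<Sum>s=1..n. W s (adj_on M (W s) x)) = x)"

definition pure_on :: "'a::chilbert_space set \<Rightarrow> nat \<Rightarrow> (nat \<Rightarrow> 'a \<Rightarrow> 'a) \<Rightarrow> bool"
  where "pure_on M n W \<longleftrightarrow>
    row_isometry_on M n W \<and>
    (\<exists>L. closed_csubspace L \<and> L \<subseteq> M \<and>
      (\<forall>\<alpha>\<in>words n. length \<alpha> \<ge> 1 \<longrightarrow> corthogonal L (word_op W \<alpha> ` L)) \<and>
      orthogonal_summands (words n) (\<lambda>\<alpha>. word_op W \<alpha> ` L) \<and>
      M = osum (words n) (\<lambda>\<alpha>. word_op W \<alpha> ` L))"

definition doubly_commuting ::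
  "nat \<Rightarrow> (nat \<Rightarrow> nat) \<Rightarrow> (nat \<Rightarrow> nat \<Rightarrow> nat \<Rightarrow> nat \<Rightarrow> complex) \<Rightarrow>
    (nat \<Rightarrow> nat \<Rightarrow> 'a::chilbert_space \<Rightarrow> 'a) \<Rightarrow> bool"
  where "doubly_commuting k n \<Lambda> V \<longleftrightarrow>
    (\<forall>i\<in>{1..k}. \<forall>j\<in>{1..k}. i \<noteq> j \<longrightarrow>
      (\<forall>s\<in>{1..n i}. \<forall>t\<in>{1..n j}. \<forall>x.
        adj (V i s) (V j t x) = cnj (\<Lambda> i j s t) *\<^sub>C V j t (adj (V i s) x)))"


section \<open>The Wold decomposition\<close>

text \<open>The summands of the spaces \<open>\<K>\<^sub>i\<^sup>(\<^sup>s\<^sup>)\<close> and \<open>\<K>\<^sub>i\<^sup>(\<^sup>c\<^sup>)\<close>, for a single row \<open>W\<close> in the role of \<open>V\<^sub>i\<close>.\<close>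

definition shift_summand :: "nat \<Rightarrow> (nat \<Rightarrow> 'a::chilbert_space \<Rightarrow> 'a) \<Rightarrow> nat list \<Rightarrow> 'a set"
  where "shift_summand n W \<alpha> = word_op W \<alpha> ` (\<Inter>m\<in>{1..n}. {x. adj (W m) x = 0})"

definition shift_part :: "nat \<Rightarrow> (nat \<Rightarrow> 'a::chilbert_space \<Rightarrow> 'a) \<Rightarrow> 'a set"
  where "shift_part n W = osum (words n) (shift_summand n W)"

definition cuntz_summand :: "(nat \<Rightarrow> 'a::chilbert_space \<Rightarrow> 'a) \<Rightarrow> nat list \<Rightarrow> 'a set"
  where "cuntz_summand W \<alpha> = range (word_op W \<alpha>)"

definition cuntz_part :: "nat \<Rightarrow> (nat \<Rightarrow> 'a::chilbert_space \<Rightarrow> 'a) \<Rightarrow> 'a set"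
  where "cuntz_part n W = (\<Inter>p::nat. osum {\<alpha> \<in> words n. length \<alpha> = p} (cuntz_summand W))"

definition wold_decomposition ::
  "nat \<Rightarrow> (nat \<Rightarrow> nat) \<Rightarrow> (nat \<Rightarrow> nat \<Rightarrow> 'a::chilbert_space \<Rightarrow> 'a) \<Rightarrow> (nat set \<Rightarrow> 'a set) \<Rightarrow> bool"
  where "wold_decomposition k n V K \<longleftrightarrow>
    orthogonal_summands (Pow {1..k}) K \<and> osum (Pow {1..k}) K = UNIV \<and>
    (\<forall>A\<in>Pow {1..k}.
      (\<forall>i\<in>{1..k}. \<forall>m\<in>{1..n i}. reducing (K A) (V i m)) \<and>
      (\<forall>i\<in>A. pure_on (K A) (n i) (V i)) \<and>
      (\<forall>i\<in>{1..k} - A. cuntz_on (K A) (n i) (V i)))"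

end

theory Submission
  imports Defs
begin

text \<open>For a single row isometry the shift part and the Cuntz part are orthogonal complements, and the
  Cuntz part is the common fixed space of the projections \<open>P\<^sub>p = \<Sum> W\<^sub>\<alpha> W\<^sub>\<alpha>\<^sup>*\<close>
  (sum over \<open>|\<alpha>| = p\<close>).  Double commutation and \<open>|\<lambda>| = 1\<close> force
  \<open>V\<^sub>i\<^sub>,\<^sub>s V\<^sub>j\<^sub>,\<^sub>t = \<lambda> V\<^sub>j\<^sub>,\<^sub>t V\<^sub>i\<^sub>,\<^sub>s\<close>, so the \<open>P\<^sub>p\<close> of one row commute with all the
  other \<open>V\<^sub>j\<^sub>,\<^sub>t\<close>; hence every Cuntz part reduces all the isometries, and the projections onto the
  Cuntz parts commute.  Splitting successively along them yields the decomposition.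
  For uniqueness, a reducing subspace on which row \<open>i\<close> is pure (Cuntz) lies in the \<open>i\<close>-th shift
  (Cuntz) part, so the summands of any competitor are contained in the summands constructed here;
  as both families are orthogonal and the smaller ones already span, they agree.\<close>

section \<open>Orthogonal complements and projections\<close>

lemma scaleC_simps [simp]:
  fixes x :: "'a::complex_vector"
  shows "c *\<^sub>C (0::'a) = 0" "(- 1) *\<^sub>C x = - x"
  by simp_all

lemma scaleR_scaleC: "r *\<^sub>R x = complex_of_real r *\<^sub>C (x::'a::complex_vector)"
  by (simp add: scaleC_of_real)

lemma cinner_add_right: "cinner x (y + z) = cinner x y + cinner x (z::'a::complex_inner)"
  by (metis cinner_add_left cinner_commute complex_cnj_add)

lemma cinner_scaleC_right: "cinner x (c *\<^sub>C y) = cnj c * cinner x (y::'a::complex_inner)"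
  by (metis cinner_commute cinner_scaleC_left complex_cnj_mult)

lemma cinner_zero [simp]: "cinner 0 x = 0" "cinner x (0::'a::complex_inner) = 0"
  using cinner_scaleC_left[of 0 0 x] cinner_scaleC_right[of x 0 0] by auto

lemma cinner_minus [simp]:
  "cinner (- x) y = - cinner x (y::'a::complex_inner)" "cinner x (- y) = - cinner x y"
  using cinner_scaleC_left[of "-1" x y] cinner_scaleC_right[of x "-1" y] by auto

lemma cinner_diff:
  "cinner (x - y) z = cinner x z - cinner y (z::'a::complex_inner)"
  "cinner z (x - y) = cinner z x - cinner z y"
  using cinner_add_left[of x "- y" z] cinner_add_right[of z x "- y"] by auto

lemma cinner_sum_left: "cinner (sum f A) (y::'a::complex_inner) = (\<Sum>i\<in>A. cinner (f i) y)"
  by (induction A rule: infinite_finite_induct) (auto simp: cinner_add_left)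

lemma cinner_sum_right: "cinner (y::'a::complex_inner) (sum f A) = (\<Sum>i\<in>A. cinner y (f i))"
  by (induction A rule: infinite_finite_induct) (auto simp: cinner_add_right)

lemma cinner_eq_0_commute: "cinner x y = 0 \<longleftrightarrow> cinner y (x::'a::complex_inner) = 0"
  by (metis cinner_commute complex_cnj_zero)

lemma cinner_self_eq_0 [simp]: "cinner x x = 0 \<longleftrightarrow> x = (0::'a::complex_inner)"
  by (simp add: cinner_self)

lemma norm_scaleC: "norm (c *\<^sub>C (x::'a::complex_inner)) = cmod c * norm x"
proof -
  have "complex_of_real ((norm (c *\<^sub>C x))\<^sup>2) = c * cnj c * complex_of_real ((norm x)\<^sup>2)"
    by (simp only: cinner_self[symmetric] cinner_scaleC_left cinner_scaleC_right mult_ac)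
  also have "\<dots> = complex_of_real ((cmod c * norm x)\<^sup>2)"
    by (simp add: complex_mult_cnj cmod_power2 power_mult_distrib)
  finally have "(norm (c *\<^sub>C x))\<^sup>2 = (cmod c * norm x)\<^sup>2"
    using of_real_eq_iff by blast
  then show ?thesis
    by simp
qed

lemma norm_diff_square:
  fixes x y :: "'a::complex_inner"
  shows "(norm (x - y))\<^sup>2 = (norm x)\<^sup>2 + (norm y)\<^sup>2 - 2 * Re (cinner x y)"
proof -
  have "complex_of_real ((norm (x - y))\<^sup>2)
      = complex_of_real ((norm x)\<^sup>2) + complex_of_real ((norm y)\<^sup>2) - (cinner x y + cnj (cinner x y))"
    by (simp only: cinner_self[symmetric] cinner_commute[of y x, symmetric] cinner_diff)
      (simp add: algebra_simps)
  then have "Re (complex_of_real ((norm (x - y))\<^sup>2))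
      = Re (complex_of_real ((norm x)\<^sup>2) + complex_of_real ((norm y)\<^sup>2) - (cinner x y + cnj (cinner x y)))"
    by (rule arg_cong)
  then show ?thesis
    by simp
qed

text \<open>Pythagoras for the projection onto the line of a unit vector. It yields both the
  Cauchy-Schwarz inequality and the optimality argument in \<open>projection_exists\<close>.\<close>

lemma norm_diff_proj:
  fixes x y :: "'a::complex_inner"
  assumes "norm y = 1"
  shows "(norm (x - cinner x y *\<^sub>C y))\<^sup>2 = (norm x)\<^sup>2 - (cmod (cinner x y))\<^sup>2"
proof -
  have "cnj (cinner x y) * cinner x y = complex_of_real ((cmod (cinner x y))\<^sup>2)"
    by (simp only: complex_norm_square mult.commute)
  then have "Re (cinner x (cinner x y *\<^sub>C y)) = (cmod (cinner x y))\<^sup>2"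
    by (simp add: cinner_scaleC_right)
  then show ?thesis
    by (simp add: norm_diff_square norm_scaleC assms)
qed

lemma Cauchy_Schwarz_cinner: "cmod (cinner x y) \<le> norm x * norm (y::'a::complex_inner)"
proof (cases "y = 0")
  case False
  define u where "u = complex_of_real (1 / norm y) *\<^sub>C y"
  have u: "norm u = 1" and y: "y = complex_of_real (norm y) *\<^sub>C u"
    using False by (auto simp: u_def norm_scaleC scaleC_scaleC norm_divide)
  have "(cmod (cinner x u))\<^sup>2 \<le> (norm x)\<^sup>2"
    using norm_diff_proj[OF u, of x] by (metis diff_ge_0_iff_ge zero_le_power2)
  then have "cmod (cinner x u) \<le> norm x"
    by simp
  moreover have "cmod (cinner x y) = norm y * cmod (cinner x u)"
    by (subst y) (simp add: cinner_scaleC_right norm_mult)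
  ultimately show ?thesis
    by (simp add: mult_left_mono mult.commute[of "norm x"])
qed simp

lemma bounded_linear_cinner_left: "bounded_linear (\<lambda>x::'a::complex_inner. cinner x y)"
  by (rule bounded_linear_intro[where K = "norm y"])
    (auto simp: cinner_add_left scaleR_scaleC cinner_scaleC_left scaleC_complex_def
      scaleR_conv_of_real Cauchy_Schwarz_cinner)

lemma bounded_linear_scaleC: "bounded_linear (\<lambda>x::'a::complex_inner. c *\<^sub>C x)"
  by (rule bounded_linear_intro[where K = "cmod c"])
    (auto simp: scaleC_add_right scaleR_scaleC scaleC_scaleC norm_scaleC mult.commute)

section \<open>Closed subspaces and closed spans\<close>

lemma closed_csubspaceD:
  assumes "closed_csubspace M"
  shows "0 \<in> M" "x \<in> M \<Longrightarrow> y \<in> M \<Longrightarrow> x + y \<in> M" "x \<in> M \<Longrightarrow> c *\<^sub>C x \<in> M"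
    "x \<in> M \<Longrightarrow> y \<in> M \<Longrightarrow> x - y \<in> M" "(\<And>i. i \<in> I \<Longrightarrow> f i \<in> M) \<Longrightarrow> sum f I \<in> M"
  using assms
  by (auto simp: closed_csubspace_def complex_vector.subspace_0 complex_vector.subspace_add
      complex_vector.subspace_scale complex_vector.subspace_diff complex_vector.subspace_sum)

lemma closed_csubspaceI:
  assumes "0 \<in> M" "\<And>x y. x \<in> M \<Longrightarrow> y \<in> M \<Longrightarrow> x + y \<in> M"
    "\<And>c x. x \<in> M \<Longrightarrow> c *\<^sub>C x \<in> M" "closed M"
  shows "closed_csubspace M"
  using assms by (auto simp: closed_csubspace_def complex_vector.subspace_def)

lemma closed_csubspace_UNIV [simp]: "closed_csubspace UNIV"
  by (rule closed_csubspaceI) auto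

lemma closed_csubspace_Int: "closed_csubspace M \<Longrightarrow> closed_csubspace N \<Longrightarrow> closed_csubspace (M \<inter> N)"
  by (auto simp: closed_csubspace_def complex_vector.subspace_inter)

lemma closed_csubspace_INT:
  assumes "\<And>i. i \<in> I \<Longrightarrow> closed_csubspace (M i)"
  shows "closed_csubspace (\<Inter>i\<in>I. M i)"
  using assms by (auto simp: closed_csubspace_def complex_vector.subspace_def)

lemma closed_csubspace_osum: "closed_csubspace (osum I F)"
proof (rule closed_csubspaceI)
  show "0 \<in> osum I F"
    unfolding osum_def using closure_subset complex_vector.span_zero by blast
next
  fix x y assume "x \<in> osum I F" "y \<in> osum I F"
  then obtain f g where "\<And>m::nat. f m \<in> cspan (\<Union>i\<in>I. F i)" "f \<longlonglongrightarrow> x"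
    "\<And>m::nat. g m \<in> cspan (\<Union>i\<in>I. F i)" "g \<longlonglongrightarrow> y"
    by (auto simp: osum_def closure_sequential)
  then have "\<And>m. f m + g m \<in> cspan (\<Union>i\<in>I. F i)" "(\<lambda>m. f m + g m) \<longlonglongrightarrow> x + y"
    by (auto intro: complex_vector.span_add tendsto_add)
  then show "x + y \<in> osum I F"
    unfolding osum_def closure_sequential by (intro exI[of _ "\<lambda>m. f m + g m"]) auto
next
  fix c x assume "x \<in> osum I F"
  then obtain f where "\<And>m::nat. f m \<in> cspan (\<Union>i\<in>I. F i)" "f \<longlonglongrightarrow> x"
    by (auto simp: osum_def closure_sequential)
  then have "\<And>m. c *\<^sub>C f m \<in> cspan (\<Union>i\<in>I. F i)" "(\<lambda>m. c *\<^sub>C f m) \<longlonglongrightarrow> c *\<^sub>C x"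
    by (auto intro: complex_vector.span_scale bounded_linear.tendsto[OF bounded_linear_scaleC])
  then show "c *\<^sub>C x \<in> osum I F"
    unfolding osum_def closure_sequential by (intro exI[of _ "\<lambda>m. c *\<^sub>C f m"]) auto
qed (simp add: osum_def)

lemma osum_superset: "i \<in> I \<Longrightarrow> F i \<subseteq> osum I F"
  unfolding osum_def
  by (rule order_trans[OF _ closure_subset], rule order_trans[OF _ complex_vector.span_superset]) blast

lemma osum_least:
  assumes "closed_csubspace M" "\<And>i. i \<in> I \<Longrightarrow> F i \<subseteq> M"
  shows "osum I F \<subseteq> M"
  unfolding osum_def using assms
  by (intro closure_minimal complex_vector.span_minimal) (auto simp: closed_csubspace_def)

section \<open>Orthogonal complements and the projection theorem\<close>

definition orthocomp :: "'a::complex_inner set \<Rightarrow> 'a set"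
  where "orthocomp S = {x. \<forall>y\<in>S. cinner x y = 0}"

lemma closed_csubspace_orthocomp: "closed_csubspace (orthocomp S)"
proof -
  have "closed {x. cinner x y = 0}" for y :: 'a
    by (intro closed_Collect_eq continuous_on_const linear_continuous_on
        bounded_linear_cinner_left)
  moreover have "orthocomp S = (\<Inter>y\<in>S. {x. cinner x y = 0})"
    by (auto simp: orthocomp_def)
  ultimately have "closed (orthocomp S)"
    by auto
  then show ?thesis
    by (intro closed_csubspaceI) (auto simp: orthocomp_def cinner_add_left cinner_scaleC_left)
qed

lemma orthocompD: "x \<in> orthocomp S \<Longrightarrow> y \<in> S \<Longrightarrow> cinner x y = 0 \<and> cinner y x = 0"
  by (auto simp: orthocomp_def cinner_eq_0_commute[of y x])

lemma orthocomp_Int_eq_0: "x \<in> orthocomp S \<Longrightarrow> x \<in> S \<Longrightarrow> x = 0"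
  using orthocompD[of x S x] by simp

text \<open>Each \<open>F i\<close> lies in \<open>orthocomp {x}\<close>, which is a closed subspace
  and hence contains the whole closed span.\<close>

lemma orthocomp_osumI:
  assumes "\<And>i y. i \<in> I \<Longrightarrow> y \<in> F i \<Longrightarrow> cinner x y = 0"
  shows "x \<in> orthocomp (osum I F)"
proof -
  have "osum I F \<subseteq> orthocomp {x}"
    using assms by (intro osum_least closed_csubspace_orthocomp)
      (auto simp: orthocomp_def cinner_eq_0_commute[of _ x])
  then show ?thesis
    by (auto simp: orthocomp_def cinner_eq_0_commute[of x])
qed

lemma parallelogram_cinner:
  fixes x y :: "'a::complex_inner"
  shows "(norm (x + y))\<^sup>2 + (norm (x - y))\<^sup>2 = 2 * (norm x)\<^sup>2 + 2 * (norm y)\<^sup>2"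
  using norm_diff_square[of x y] norm_diff_square[of x "- y"] by simp

text \<open>A sequence in \<open>M\<close> minimising the distance to \<open>x\<close> is Cauchy,
  and its limit is the foot of the perpendicular.\<close>

lemma projection_exists:
  fixes M :: "'a::chilbert_space set"
  assumes M: "closed_csubspace M"
  obtains y z where "x = y + z" "y \<in> M" "z \<in> orthocomp M"
proof -
  define d where "d = (INF m\<in>M. norm (x - m))"
  have bdd: "bdd_below ((\<lambda>m. norm (x - m)) ` M)"
    by (rule bdd_belowI[of _ 0]) auto
  have ne: "M \<noteq> {}"
    using closed_csubspaceD(1)[OF M] by auto
  have d_le: "d \<le> norm (x - m)" if "m \<in> M" for m
    unfolding d_def using bdd that by (rule cINF_lower)
  have d0: "d \<ge> 0"
    unfolding d_def using ne by (intro cINF_greatest) auto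
  have "\<exists>m\<in>M. norm (x - m) < d + 1 / Suc i" for i :: nat
  proof -
    have "d < d + 1 / Suc i"
      by simp
    then show ?thesis
      unfolding d_def cINF_less_iff[OF ne bdd] .
  qed
  then obtain f where f: "f i \<in> M" "norm (x - f i) < d + 1 / Suc i" for i :: nat
    by metis
  have lim: "(\<lambda>i. norm (x - f i)) \<longlonglongrightarrow> d"
  proof (rule tendsto_sandwich[of "\<lambda>_. d" _ _ "\<lambda>i. d + 1 / Suc i"])
    show "(\<lambda>i. d + 1 / real (Suc i)) \<longlonglongrightarrow> d"
      using tendsto_add[OF tendsto_const[of d] LIMSEQ_inverse_real_of_nat]
      by (simp add: inverse_eq_divide)
    show "\<forall>\<^sub>F i in sequentially. norm (x - f i) \<le> d + 1 / real (Suc i)"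
      using f(2) by (intro always_eventually allI less_imp_le) auto
  qed (use d_le f(1) in auto)
  \<comment> \<open>Parallelogram law for \<open>x - f i\<close> and \<open>x - f j\<close>: their
    sum is twice \<open>x - h\<close>, and the midpoint \<open>h\<close> lies in \<open>M\<close>,
    hence at distance at least \<open>d\<close> from \<open>x\<close>.\<close>
  have bound: "(norm (f i - f j))\<^sup>2 \<le> 2 * (norm (x - f i))\<^sup>2 + 2 * (norm (x - f j))\<^sup>2 - 4 * d\<^sup>2" for i j
  proof -
    define h where "h = (1/2) *\<^sub>R (f i + f j)"
    have "h \<in> M"
      unfolding h_def scaleR_scaleC using f(1) M by (intro closed_csubspaceD) auto
    have eq: "(x - f i) + (x - f j) = 2 *\<^sub>R (x - h)"
      by (simp add: h_def algebra_simps scaleR_2)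
    have "norm ((x - f i) + (x - f j)) = 2 * norm (x - h)"
      unfolding eq by simp
    moreover have "d\<^sup>2 \<le> (norm (x - h))\<^sup>2"
      using d_le[OF \<open>h \<in> M\<close>] d0 by (simp add: power_mono)
    ultimately have "4 * d\<^sup>2 \<le> (norm ((x - f i) + (x - f j)))\<^sup>2"
      by (simp add: power_mult_distrib)
    then show ?thesis
      using parallelogram_cinner[of "x - f i" "x - f j"] by (simp add: norm_minus_commute)
  qed
  have "Cauchy f"
  proof (rule metric_CauchyI)
    fix e :: real assume "e > 0"
    have "(\<lambda>i. (norm (x - f i))\<^sup>2) \<longlonglongrightarrow> d\<^sup>2"
      using lim by (intro tendsto_intros)
    then have "\<forall>\<^sub>F i in sequentially. (norm (x - f i))\<^sup>2 < d\<^sup>2 + e\<^sup>2 / 4"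
      using \<open>e > 0\<close> by (intro order_tendstoD) auto
    then obtain N where N: "\<And>i. i \<ge> N \<Longrightarrow> (norm (x - f i))\<^sup>2 < d\<^sup>2 + e\<^sup>2 / 4"
      by (auto simp: eventually_sequentially)
    have "dist (f i) (f j) < e" if "i \<ge> N" "j \<ge> N" for i j
    proof -
      have "(norm (f i - f j))\<^sup>2 < e\<^sup>2"
        using bound[of i j] N[OF that(1)] N[OF that(2)] by simp
      then show ?thesis
        using \<open>e > 0\<close> by (simp add: dist_norm power_less_imp_less_base)
    qed
    then show "\<exists>N. \<forall>i\<ge>N. \<forall>j\<ge>N. dist (f i) (f j) < e"
      by blast
  qed
  then obtain y where y: "f \<longlonglongrightarrow> y"
    using Cauchy_convergent convergent_def by blast
  have "y \<in> M"
    using M y f(1) by (auto simp: closed_csubspace_def closed_sequential_limits)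
  have "(\<lambda>i. norm (x - f i)) \<longlonglongrightarrow> norm (x - y)"
    using y by (intro tendsto_intros)
  then have dist_y: "norm (x - y) = d"
    using lim LIMSEQ_unique by blast
  have "cinner (x - y) m = 0" if "m \<in> M" for m
  proof (cases "m = 0")
    case False
    define u where "u = complex_of_real (1 / norm m) *\<^sub>C m"
    have u: "norm u = 1" "u \<in> M" and m: "m = complex_of_real (norm m) *\<^sub>C u"
      using False closed_csubspaceD(3)[OF M that]
      by (auto simp: u_def norm_scaleC scaleC_scaleC norm_divide)
    \<comment> \<open>Moving \<open>y\<close> by the projection of \<open>x - y\<close> onto the
      line of \<open>u\<close> stays in \<open>M\<close>, so it cannot get closer to
      \<open>x\<close> than \<open>d\<close>. By \<open>norm_diff_proj\<close> the coefficient must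
      vanish.\<close>
    have "y + cinner (x - y) u *\<^sub>C u \<in> M"
      using M \<open>y \<in> M\<close> u by (intro closed_csubspaceD) auto
    from d_le[OF this] have "d\<^sup>2 \<le> (norm (x - y - cinner (x - y) u *\<^sub>C u))\<^sup>2"
      using d0 by (simp add: diff_diff_eq power_mono)
    also have "\<dots> = d\<^sup>2 - (cmod (cinner (x - y) u))\<^sup>2"
      using norm_diff_proj[OF u(1), of "x - y"] dist_y by simp
    finally have "cinner (x - y) u = 0"
      by simp
    then show ?thesis
      by (subst m) (simp add: cinner_scaleC_right)
  qed simp
  then have "x - y \<in> orthocomp M"
    by (simp add: orthocomp_def)
  then show ?thesis
    using that[of y "x - y"] \<open>y \<in> M\<close> by simp
qed

lemma orthocomp_orthocomp:
  fixes M :: "'a::chilbert_space set"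
  assumes "closed_csubspace M"
  shows "orthocomp (orthocomp M) = M"
proof
  show "orthocomp (orthocomp M) \<subseteq> M"
  proof
    fix x assume x: "x \<in> orthocomp (orthocomp M)"
    obtain y z where yz: "x = y + z" "y \<in> M" "z \<in> orthocomp M"
      using projection_exists[OF assms] by blast
    have "cinner z z = cinner x z - cinner y z"
      by (simp add: yz(1) cinner_add_left)
    also have "\<dots> = 0"
      using orthocompD[OF x yz(3)] orthocompD[OF yz(3,2)] by simp
    finally show "x \<in> M"
      using yz by simp
  qed
qed (auto simp: orthocomp_def cinner_eq_0_commute)

section \<open>Adjoints\<close>

text \<open>If \<open>f\<close> is nonzero, some \<open>z\<close> orthogonal to its kernel has
  nonzero value. Since \<open>x - (f x / f z) *\<^sub>C z\<close> lies in the kernel, a multiple of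
  \<open>z\<close> represents \<open>f\<close>.\<close>

lemma Riesz_representation:
  fixes f :: "'a::chilbert_space \<Rightarrow> complex"
  assumes lin: "bounded_linear f" and scale: "\<And>c x. f (c *\<^sub>C x) = c * f x"
  obtains y where "\<And>x. f x = cinner x y"
proof (cases "\<forall>x. f x = 0")
  case True
  then show ?thesis
    using that[of 0] by simp
next
  case False
  then obtain x0 where x0: "f x0 \<noteq> 0"
    by blast
  interpret f: bounded_linear f
    by (rule lin)
  have ker: "closed_csubspace {x. f x = 0}"
    by (intro closed_csubspaceI closed_Collect_eq linear_continuous_on lin continuous_on_const)
      (auto simp: f.add scale)
  obtain u z where uz: "x0 = u + z" "f u = 0" "z \<in> orthocomp {x. f x = 0}"
    using projection_exists[OF ker] by blast
  then have fz: "f z \<noteq> 0"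
    using x0 f.add by auto
  then have z: "z \<noteq> 0"
    using f.zero by auto
  \<comment> \<open>The scalar makes \<open>cinner z y = f z\<close>; the conjugate compensates for
    conjugate-linearity in the second argument.\<close>
  define y where "y = cnj (f z / cinner z z) *\<^sub>C z"
  have "f x = cinner x y" for x
  proof -
    have "f (x - (f x / f z) *\<^sub>C z) = 0"
      using fz by (simp add: f.diff scale)
    then have "cinner (x - (f x / f z) *\<^sub>C z) z = 0"
      using orthocompD[OF uz(3)] by blast
    then have "cinner x z = f x / f z * cinner z z"
      by (simp add: cinner_diff cinner_scaleC_left)
    then show ?thesis
      using fz z by (simp add: y_def cinner_scaleC_right)
  qed
  then show ?thesis
    by (rule that)
qed

lemma bounded_opD:
  assumes "bounded_op_on UNIV T"
  shows "T (x + y) = T x + T y" "T (c *\<^sub>C x) = c *\<^sub>C T x" "bounded_linear T"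
proof -
  from assms obtain B where "\<forall>x. norm (T x) \<le> B * norm x"
    by (auto simp: bounded_op_on_def)
  with assms show "bounded_linear T"
    by (intro bounded_linear_intro[where K = B])
      (auto simp: bounded_op_on_def scaleR_scaleC mult.commute)
qed (use assms in \<open>auto simp: bounded_op_on_def\<close>)

text \<open>\<open>adj\<close> is a \<open>SOME\<close> choice, so its properties become available
  only through existence. Riesz applied to each functional \<open>cinner (T x) y\<close> gives
  \<open>S y\<close>; the bound comes from rewriting \<open>cinner (S y) (S y)\<close> as
  \<open>cinner (T (S y)) y\<close>.\<close>

lemma adjoint_exists:
  fixes T :: "'a::chilbert_space \<Rightarrow> 'a"
  assumes T: "bounded_op_on UNIV T"
  shows "\<exists>S. bounded_op_on UNIV S \<and> (\<forall>x y. cinner (T x) y = cinner x (S y))"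
proof -
  have "\<exists>z. \<forall>x. cinner (T x) y = cinner x z" for y
    by (rule Riesz_representation[of "\<lambda>x. cinner (T x) y"])
      (auto simp: bounded_opD[OF T] cinner_scaleC_left
        intro: bounded_linear_compose[OF bounded_linear_cinner_left] bounded_opD(3)[OF T])
  then obtain S where S: "\<And>x y. cinner (T x) y = cinner x (S y)"
    by metis
  have eqI: "u = v" if "\<And>x. cinner x u = cinner x v" for u v :: 'a
    using that[of "u - v"] by (metis cinner_diff(2) cinner_self_eq_0 eq_iff_diff_eq_0)
  obtain B where B: "\<And>x. norm (T x) \<le> norm x * B"
    using bounded_linear.bounded[OF bounded_opD(3)[OF T]] by blast
  have "norm (S y) \<le> B * norm y" for y
  proof (cases "S y = 0")
    case True
    \<comment> \<open>The sign of \<open>B\<close> is not given, so here the bound has to be seen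
      nonnegative from the estimate of \<open>norm (T y)\<close>.\<close>
    have "0 \<le> norm y * B"
      using norm_ge_zero[of "T y"] B[of y] by linarith
    then show ?thesis
      using True by (simp add: mult.commute)
  next
    case False
    have "(norm (S y))\<^sup>2 = cmod (cinner (S y) (S y))"
      by (simp add: cinner_self norm_power)
    also have "\<dots> \<le> norm (T (S y)) * norm y"
      using Cauchy_Schwarz_cinner[of "T (S y)" y] by (simp add: S)
    also have "\<dots> \<le> (norm (S y) * B) * norm y"
      by (intro mult_right_mono B) auto
    finally show ?thesis
      using False by (simp add: power2_eq_square mult.assoc)
  qed
  then have "bounded_op_on UNIV S"
    by (auto simp: bounded_op_on_def cinner_add_right cinner_scaleC_right S[symmetric] intro!: eqI)
  with S show ?thesis
    by blast
qed

lemma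
  fixes T :: "'a::chilbert_space \<Rightarrow> 'a"
  assumes "bounded_op_on UNIV T"
  shows bounded_op_adj: "bounded_op_on UNIV (adj T)"
    and cinner_adj: "cinner (T x) y = cinner x (adj T y)"
proof -
  have "bounded_op_on UNIV (adj T) \<and> (\<forall>x\<in>UNIV. \<forall>y\<in>UNIV. cinner (T x) y = cinner x (adj T y))"
    unfolding adj_on_def[of UNIV T]
    using someI_ex[OF adjoint_exists[OF assms]] unfolding ball_UNIV .
  then show "bounded_op_on UNIV (adj T)" "cinner (T x) y = cinner x (adj T y)"
    by blast+
qed

lemma cinner_adj_left:
  fixes T :: "'a::chilbert_space \<Rightarrow> 'a"
  assumes "bounded_op_on UNIV T"
  shows "cinner (adj T x) y = cinner x (T y)"
  by (metis assms cinner_adj cinner_commute)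

section \<open>Adjoints on reducing subspaces\<close>

lemma bounded_op_on_subset:
  "bounded_op_on UNIV T \<Longrightarrow> T ` M \<subseteq> M \<Longrightarrow> bounded_op_on M T"
  by (auto simp: bounded_op_on_def)

lemma bounded_op_on_reducing:
  assumes "bounded_op_on UNIV T" "reducing M T"
  shows "bounded_op_on M T" "bounded_op_on M (adj T)"
  using assms bounded_op_adj[OF assms(1)] by (simp_all add: reducing_def bounded_op_on_subset)

text \<open>Allows notions relative to a reducing subspace to be computed with the ambient adjoint.
  Both candidates have the same inner products with vectors of \<open>M\<close>, and their
  difference lies in \<open>M\<close>.\<close>

lemma adj_on_reducing:
  fixes T :: "'a::chilbert_space \<Rightarrow> 'a"
  assumes T: "bounded_op_on UNIV T" and M: "reducing M T" and y: "y \<in> M"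
  shows "adj_on M T y = adj T y"
proof -
  have "\<exists>S. bounded_op_on M S \<and> (\<forall>x\<in>M. \<forall>y\<in>M. cinner (T x) y = cinner x (S y))"
    using bounded_op_on_reducing[OF T M] cinner_adj[OF T] by blast
  from someI_ex[OF this]
  have "bounded_op_on M (adj_on M T) \<and> (\<forall>x\<in>M. \<forall>y\<in>M. cinner (T x) y = cinner x (adj_on M T y))"
    unfolding adj_on_def[of M T] .
  then have *: "adj_on M T y \<in> M" "\<And>x. x \<in> M \<Longrightarrow> cinner x (adj T y) = cinner x (adj_on M T y)"
    using y cinner_adj[OF T] by (auto simp: bounded_op_on_def)
  have "adj T y - adj_on M T y \<in> M"
    using * M y by (intro closed_csubspaceD) (auto simp: reducing_def)
  from *(2)[OF this] have "cinner (adj T y - adj_on M T y) (adj T y - adj_on M T y) = 0"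
    by (simp add: cinner_diff(2))
  then show ?thesis
    by simp
qed


section \<open>Bounded operators, their preimages, fixed points and isometric images\<close>

lemma bounded_op_iff:
  "bounded_op_on UNIV (T :: 'a::complex_inner \<Rightarrow> 'a) \<longleftrightarrow> bounded_linear T \<and> (\<forall>c x. T (c *\<^sub>C x) = c *\<^sub>C T x)"
proof
  assume "bounded_linear T \<and> (\<forall>c x. T (c *\<^sub>C x) = c *\<^sub>C T x)"
  then show "bounded_op_on UNIV T"
    using bounded_linear.bounded[of T] linear_add[OF bounded_linear.linear[of T]]
    by (auto simp: bounded_op_on_def mult.commute)
qed (auto simp: bounded_opD)

lemma bounded_op_zero: "bounded_op_on UNIV T \<Longrightarrow> T 0 = 0"
  by (rule linear_simps(3)) (rule bounded_opD(3))

lemma bounded_op_diff: "bounded_op_on UNIV T \<Longrightarrow> T (x - y) = T x - T y"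
  by (rule linear_simps(2)) (rule bounded_opD(3))

lemma bounded_op_sum: "bounded_op_on UNIV T \<Longrightarrow> T (sum f A) = (\<Sum>i\<in>A. T (f i))"
  by (rule linear_sum) (auto dest: bounded_opD(3) bounded_linear.linear)

lemma bounded_op_id: "bounded_op_on UNIV (\<lambda>x. x)"
  by (simp add: bounded_op_iff)

lemma bounded_op_compose:
  "bounded_op_on UNIV S \<Longrightarrow> bounded_op_on UNIV T \<Longrightarrow> bounded_op_on UNIV (\<lambda>x. S (T x))"
  by (simp add: bounded_op_iff bounded_linear_compose)

lemma bounded_op_sum_fun:
  assumes "\<And>i. i \<in> I \<Longrightarrow> bounded_op_on UNIV (T i)"
  shows "bounded_op_on UNIV (\<lambda>x. \<Sum>i\<in>I. T i x)"
  using assms unfolding bounded_op_iff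
  by (auto intro!: bounded_linear_sum simp: complex_vector.scale_sum_right)

lemma closed_csubspace_vimage:
  assumes T: "bounded_op_on UNIV T" and "closed_csubspace N"
  shows "closed_csubspace {x. T x \<in> N}"
proof -
  have "closed (T -` N)"
    using assms by (intro continuous_closed_vimage)
      (auto simp: closed_csubspace_def intro: linear_continuous_at bounded_opD)
  then show ?thesis
    using assms by (intro closed_csubspaceI)
      (auto simp: vimage_def bounded_op_zero bounded_opD closed_csubspaceD)
qed

lemma closed_csubspace_fixed_points:
  assumes T: "bounded_op_on UNIV T"
  shows "closed_csubspace {x. T x = x}"
  by (intro closed_csubspaceI closed_Collect_eq linear_continuous_on bounded_opD(3)[OF T]
      continuous_on_id) (auto simp: bounded_op_zero[OF T] bounded_opD[OF T])

text \<open>Isometries preserve completeness, and in a complete space the complete subsets are the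
  closed ones.\<close>

lemma closed_csubspace_isometric_image:
  fixes T :: "'a::chilbert_space \<Rightarrow> 'a"
  assumes T: "bounded_op_on UNIV T" and iso: "\<And>x. norm (T x) = norm x" and L: "closed_csubspace L"
  shows "closed_csubspace (T ` L)"
proof (rule closed_csubspaceI)
  have "subspace L"
    using closed_csubspaceD[OF L] by (auto simp: subspace_def scaleR_scaleC)
  moreover have "complete L"
    using L by (simp add: closed_csubspace_def complete_eq_closed)
  ultimately have "complete (T ` L)"
    by (intro complete_isometric_image[of 1]) (auto simp: bounded_opD[OF T] iso)
  then show "closed (T ` L)"
    by (simp add: complete_eq_closed)
  show "0 \<in> T ` L"
    using closed_csubspaceD(1)[OF L] bounded_op_zero[OF T] by force
  show "x + y \<in> T ` L" if "x \<in> T ` L" "y \<in> T ` L" for x y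
    using that closed_csubspaceD(2)[OF L] by (auto simp: bounded_opD(1)[OF T, symmetric])
  show "c *\<^sub>C x \<in> T ` L" if "x \<in> T ` L" for c x
    using that closed_csubspaceD(3)[OF L] by (auto simp: bounded_opD(2)[OF T, symmetric])
qed

section \<open>Reducing subspaces\<close>

lemma reducingD:
  assumes "reducing M T"
  shows "closed_csubspace M" "x \<in> M \<Longrightarrow> T x \<in> M" "x \<in> M \<Longrightarrow> adj T x \<in> M"
  using assms by (auto simp: reducing_def)

lemma reducing_UNIV: "reducing UNIV T"
  by (simp add: reducing_def)

lemma reducing_orthocomp:
  assumes T: "bounded_op_on UNIV T" and M: "reducing M T"
  shows "reducing (orthocomp M) T"
  unfolding reducing_def
  using closed_csubspace_orthocomp reducingD[OF M]
  by (auto simp: orthocomp_def cinner_adj[OF T] cinner_adj_left[OF T])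

lemma reducing_INT:
  assumes "\<And>i. i \<in> I \<Longrightarrow> reducing (M i) T"
  shows "reducing (\<Inter>i\<in>I. M i) T"
  using closed_csubspace_INT[of I M] reducingD[OF assms] by (auto simp: reducing_def)

lemma reducing_Int: "reducing M T \<Longrightarrow> reducing N T \<Longrightarrow> reducing (M \<inter> N) T"
  by (auto simp: reducing_def closed_csubspace_Int)

section \<open>A single row isometry\<close>

text \<open>This is \<open>\<Sum> W\<^sub>\<alpha> W\<^sub>\<alpha>\<^sup>*\<close> over the words \<open>\<alpha>\<close> of length \<open>p\<close>; the recursion avoids sums over words.\<close>

primrec range_proj :: "nat \<Rightarrow> (nat \<Rightarrow> 'a::chilbert_space \<Rightarrow> 'a) \<Rightarrow> nat \<Rightarrow> 'a \<Rightarrow> 'a"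
  where "range_proj n W 0 x = x"
  | "range_proj n W (Suc p) x = (\<Sum>s=1..n. W s (range_proj n W p (adj (W s) x)))"

declare One_nat_def [simp del]

locale row_isometry =
  fixes n :: nat and W :: "nat \<Rightarrow> 'a::chilbert_space \<Rightarrow> 'a"
  assumes row: "row_isometry_on UNIV n W"
begin

abbreviation wandering :: "'a set"
  where "wandering \<equiv> (\<Inter>m\<in>{1..n}. {x. adj (W m) x = 0})"

abbreviation P :: "nat \<Rightarrow> 'a \<Rightarrow> 'a"
  where "P \<equiv> range_proj n W"

section \<open>Row operators and range projections\<close>

lemma bounded_W: "s \<in> {1..n} \<Longrightarrow> bounded_op_on UNIV (W s)"
  using row by (auto simp: row_isometry_on_def)

lemma bounded_adj_W: "s \<in> {1..n} \<Longrightarrow> bounded_op_on UNIV (adj (W s))"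
  by (simp add: bounded_W bounded_op_adj)

lemma adj_W_W:
  "s \<in> {1..n} \<Longrightarrow> t \<in> {1..n} \<Longrightarrow> adj (W s) (W t x) = (if s = t then x else 0)"
  using row by (auto simp: row_isometry_on_def)

lemma adj_W_sum:
  assumes "s \<in> {1..n}"
  shows "adj (W s) (\<Sum>t=1..n. W t (f t)) = f s"
proof -
  have "adj (W s) (\<Sum>t=1..n. W t (f t)) = (\<Sum>t=1..n. if t = s then f t else 0)"
    unfolding bounded_op_sum[OF bounded_adj_W[OF assms]]
    by (rule sum.cong) (use assms in \<open>auto simp: adj_W_W\<close>)
  then show ?thesis
    using assms by simp
qed

lemma bounded_P: "bounded_op_on UNIV (P p)"
proof (induction p)
  case 0
  show ?case
    by (simp add: bounded_op_id)
next
  case (Suc p)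
  show ?case
    unfolding range_proj.simps
    by (intro bounded_op_sum_fun bounded_op_compose[OF bounded_W] bounded_op_compose[OF Suc]
        bounded_adj_W)
qed

lemma P_selfadjoint: "cinner (P p x) y = cinner x (P p y)"
  by (induction p arbitrary: x y)
    (auto simp: cinner_sum_left cinner_sum_right cinner_adj[OF bounded_W]
      cinner_adj_left[OF bounded_W, symmetric] intro!: sum.cong)

lemma P_in_reducing:
  assumes "\<forall>s\<in>{1..n}. reducing M (W s)" "closed_csubspace M" "x \<in> M"
  shows "P p x \<in> M"
  using assms(3)
  by (induction p arbitrary: x)
    (use assms(1) in \<open>auto intro!: closed_csubspaceD(5)[OF assms(2)] dest: reducingD\<close>)

section \<open>Words in the row and their orthogonality relations\<close>

lemma bounded_word_op: "\<alpha> \<in> words n \<Longrightarrow> bounded_op_on UNIV (word_op W \<alpha>)"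
proof (induction \<alpha>)
  case (Cons s \<alpha>)
  then show ?case
    using bounded_op_compose[OF bounded_W[of s]] by (simp add: comp_def)
qed (simp add: id_def bounded_op_id)

lemma cinner_word_op: "\<alpha> \<in> words n \<Longrightarrow> cinner (word_op W \<alpha> x) (word_op W \<alpha> y) = cinner x y"
  by (induction \<alpha>) (auto simp: cinner_adj[OF bounded_W] adj_W_W)

lemma norm_word_op: "\<alpha> \<in> words n \<Longrightarrow> norm (word_op W \<alpha> x) = norm x"
proof -
  assume "\<alpha> \<in> words n"
  then have "complex_of_real ((norm (word_op W \<alpha> x))\<^sup>2) = complex_of_real ((norm x)\<^sup>2)"
    using cinner_word_op[of \<alpha> x x] by (simp only: cinner_self)
  then have "(norm (word_op W \<alpha> x))\<^sup>2 = (norm x)\<^sup>2"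
    using of_real_eq_iff by blast
  then show ?thesis
    by simp
qed

lemma word_op_in_reducing:
  assumes "\<forall>s\<in>{1..n}. reducing M (W s)" "\<alpha> \<in> words n" "x \<in> M"
  shows "word_op W \<alpha> x \<in> M"
  using assms(2) by (induction \<alpha>) (use assms(1,3) in \<open>auto dest: reducingD\<close>)

lemma closed_csubspace_word_op_image:
  "\<alpha> \<in> words n \<Longrightarrow> closed_csubspace L \<Longrightarrow> closed_csubspace (word_op W \<alpha> ` L)"
  by (intro closed_csubspace_isometric_image bounded_word_op norm_word_op)

text \<open>Equal first letters cancel and different ones have orthogonal ranges. If one word runs
  out first, the next letter of the other moves across as an adjoint and kills a wandering
  vector.\<close>

lemma cinner_wandering:
  assumes "\<alpha> \<in> words n" "\<beta> \<in> words n" "\<alpha> \<noteq> \<beta>" "x \<in> wandering" "y \<in> wandering"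
  shows "cinner (word_op W \<alpha> x) (word_op W \<beta> y) = 0"
  using assms(1-3)
proof (induction \<alpha> arbitrary: \<beta>)
  case Nil
  then obtain t \<gamma> where "\<beta> = t # \<gamma>" "t \<in> {1..n}"
    by (cases \<beta>) auto
  then show ?case
    using \<open>x \<in> wandering\<close> by (simp add: cinner_adj_left[OF bounded_W, symmetric])
next
  case (Cons s \<alpha>)
  then have s: "s \<in> {1..n}"
    by simp
  show ?case
  proof (cases \<beta>)
    case Nil
    then show ?thesis
      using s \<open>y \<in> wandering\<close> by (simp add: cinner_adj[OF bounded_W])
  next
    case (Cons t \<gamma>)
    then show ?thesis
      using s Cons.prems Cons.IH[of \<gamma>] by (auto simp: cinner_adj[OF bounded_W] adj_W_W)
  qed
qed

text \<open>Words of equal length cannot run out separately, so cancelling equal letters ends at two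
  different ones; this works for arbitrary vectors.\<close>

lemma cinner_same_length:
  assumes "\<alpha> \<in> words n" "\<beta> \<in> words n" "\<alpha> \<noteq> \<beta>" "length \<alpha> = length \<beta>"
  shows "cinner (word_op W \<alpha> x) (word_op W \<beta> y) = 0"
  using assms
proof (induction \<alpha> arbitrary: \<beta> rule: list.induct)
  case (Cons s \<alpha>)
  then obtain t \<gamma> where \<beta>: "\<beta> = t # \<gamma>"
    by (cases \<beta>) auto
  have s: "s \<in> {1..n}" and t: "t \<in> {1..n}"
    using Cons.prems \<beta> by auto
  have "cinner (word_op W (s # \<alpha>) x) (word_op W \<beta> y)
      = cinner (word_op W \<alpha> x) (if s = t then word_op W \<gamma> y else 0)"
    using s t by (simp add: \<beta> cinner_adj[OF bounded_W] adj_W_W)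
  then show ?case
    using Cons.prems Cons.IH[of \<gamma>] by (auto simp: \<beta>)
qed simp

lemma closed_csubspace_wandering: "closed_csubspace wandering"
proof (rule closed_csubspace_INT)
  fix m assume m: "m \<in> {1..n}"
  have "closed_csubspace {0::'a}"
    by (rule closed_csubspaceI) auto
  from closed_csubspace_vimage[OF bounded_adj_W[OF m] this]
  show "closed_csubspace {x. adj (W m) x = 0}"
    by simp
qed

text \<open>Stated for subspaces of the wandering space because \<open>pure_on_iff\<close> uses it
  for \<open>wandering \<inter> M\<close>.\<close>

lemma orthogonal_summands_wandering:
  assumes "closed_csubspace L" "L \<subseteq> wandering"
  shows "orthogonal_summands (words n) (\<lambda>\<alpha>. word_op W \<alpha> ` L)"
  unfolding orthogonal_summands_def corthogonal_def
proof (intro conjI ballI impI)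
  fix \<alpha> \<beta> x y
  assume *: "\<alpha> \<in> words n" "\<beta> \<in> words n" "\<alpha> \<noteq> \<beta>" "x \<in> word_op W \<alpha> ` L" "y \<in> word_op W \<beta> ` L"
  then obtain u v where "x = word_op W \<alpha> u" "y = word_op W \<beta> v" "u \<in> wandering" "v \<in> wandering"
    using assms(2) by auto
  then show "cinner x y = 0"
    using cinner_wandering[OF *(1-3)] by simp
qed (rule closed_csubspace_word_op_image[OF _ assms(1)])

lemma orthogonal_summands_shift: "orthogonal_summands (words n) (shift_summand n W)"
  using orthogonal_summands_wandering[OF closed_csubspace_wandering order_refl]
  by (simp add: shift_summand_def[abs_def])

lemma orthogonal_summands_cuntz:
  "orthogonal_summands {\<alpha> \<in> words n. length \<alpha> = p} (cuntz_summand W)"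
  unfolding orthogonal_summands_def corthogonal_def cuntz_summand_def
  using closed_csubspace_word_op_image cinner_same_length by auto

text \<open>Replaces a closed span by a fixed point equation: \<open>P p\<close> fixes the range of
  every word of length \<open>p\<close>, and all its values lie in the closed span of these
  ranges.\<close>

lemma osum_cuntz_summand:
  "osum {\<alpha> \<in> words n. length \<alpha> = p} (cuntz_summand W) = {x. P p x = x}"
proof
  show "osum {\<alpha> \<in> words n. length \<alpha> = p} (cuntz_summand W) \<subseteq> {x. P p x = x}"
  proof (rule osum_least)
    have "P (length \<alpha>) (word_op W \<alpha> y) = word_op W \<alpha> y" if "\<alpha> \<in> words n" for \<alpha> y
      using that
    proof (induction \<alpha>)
      case (Cons s \<alpha>)
      then have s: "s \<in> {1..n}"
        by simp
      have "P (length (s # \<alpha>)) (word_op W (s # \<alpha>) y)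
          = (\<Sum>t=1..n. if t = s then W s (P (length \<alpha>) (word_op W \<alpha> y)) else 0)"
        unfolding range_proj.simps length_Cons
        by (rule sum.cong) (use s in \<open>auto simp: adj_W_W bounded_op_zero bounded_W bounded_P\<close>)
      then show ?case
        using s Cons by simp
    qed simp
    then show "\<And>\<alpha>. \<alpha> \<in> {\<alpha> \<in> words n. length \<alpha> = p} \<Longrightarrow> cuntz_summand W \<alpha> \<subseteq> {x. P p x = x}"
      by (auto simp: cuntz_summand_def)
  qed (rule closed_csubspace_fixed_points[OF bounded_P])
next
  \<comment> \<open>Shown for every \<open>x\<close>; a fixed point then lies in the closed span as
    its own image.\<close>
  have "P p x \<in> osum {\<alpha> \<in> words n. length \<alpha> = p} (cuntz_summand W)" for x
  proof (induction p arbitrary: x)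
    case 0
    have "x \<in> cuntz_summand W []"
      by (simp add: cuntz_summand_def)
    then show ?case
      using osum_superset[of "[]" "{\<alpha> \<in> words n. length \<alpha> = 0}" "cuntz_summand W"] by auto
  next
    case (Suc p)
    let ?N = "osum {\<alpha> \<in> words n. length \<alpha> = Suc p} (cuntz_summand W)"
    have "W s y \<in> ?N" if s: "s \<in> {1..n}"
      and y: "y \<in> osum {\<alpha> \<in> words n. length \<alpha> = p} (cuntz_summand W)" for s y
    proof -
      \<comment> \<open>The vectors that \<open>W s\<close> sends into \<open>?N\<close> form a
        closed subspace, so it is enough that it contains each summand for length
        \<open>p\<close>.\<close>
      have "osum {\<alpha> \<in> words n. length \<alpha> = p} (cuntz_summand W) \<subseteq> {x. W s x \<in> ?N}"
      proof (rule osum_least)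
        show "closed_csubspace {x. W s x \<in> ?N}"
          by (intro closed_csubspace_vimage bounded_W s closed_csubspace_osum)
        show "cuntz_summand W \<alpha> \<subseteq> {x. W s x \<in> ?N}" if "\<alpha> \<in> {\<alpha> \<in> words n. length \<alpha> = p}" for \<alpha>
          using osum_superset[of "s # \<alpha>" "{\<alpha> \<in> words n. length \<alpha> = Suc p}" "cuntz_summand W"] s that
          by (auto simp: cuntz_summand_def)
      qed
      then show ?thesis
        using y by auto
    qed
    then show ?case
      unfolding range_proj.simps by (intro closed_csubspaceD(5)[OF closed_csubspace_osum]) (use Suc in auto)
  qed
  then show "{x. P p x = x} \<subseteq> osum {\<alpha> \<in> words n. length \<alpha> = p} (cuntz_summand W)"
    by (metis (mono_tags, lifting) mem_Collect_eq subsetI)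
qed

section \<open>The Cuntz part and the shift part as orthogonal complements\<close>

lemma cuntz_part_eq: "cuntz_part n W = {x. \<forall>p. P p x = x}"
  unfolding cuntz_part_def osum_cuntz_summand by auto

lemma closed_csubspace_cuntz_part: "closed_csubspace (cuntz_part n W)"
  unfolding cuntz_part_def by (intro closed_csubspace_INT closed_csubspace_osum)

text \<open>The defect \<open>x - \<Sum> W\<^sub>s W\<^sub>s\<^sup>* x\<close> is a wandering vector of \<open>M\<close>, so it vanishes for \<open>x\<close> orthogonal to
  the shift part of \<open>M\<close>; that complement is invariant under the \<open>W\<^sub>s\<^sup>*\<close>.\<close>

lemma P_fixed_if_orthogonal:
  assumes red: "\<forall>s\<in>{1..n}. reducing M (W s)" and M: "closed_csubspace M"
    and "x \<in> M" "x \<in> orthocomp (osum (words n) (\<lambda>\<alpha>. word_op W \<alpha> ` (wandering \<inter> M)))"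
  shows "P p x = x"
  using assms(3,4)
proof (induction p arbitrary: x)
  case (Suc p)
  let ?S = "osum (words n) (\<lambda>\<alpha>. word_op W \<alpha> ` (wandering \<inter> M))"
  have sub: "word_op W \<alpha> ` (wandering \<inter> M) \<subseteq> ?S" if "\<alpha> \<in> words n" for \<alpha>
    using osum_superset[OF that, of "\<lambda>\<alpha>. word_op W \<alpha> ` (wandering \<inter> M)"] .
  define q where "q = x - (\<Sum>s=1..n. W s (adj (W s) x))"
  have "W s (adj (W s) x) \<in> M" if "s \<in> {1..n}" for s
    using red that Suc.prems(1) reducingD(2,3) by blast
  then have "q \<in> M"
    unfolding q_def using Suc.prems(1) by (intro closed_csubspaceD(4,5)[OF M])
  moreover have adj_q: "adj (W s) q = 0" if "s \<in> {1..n}" for s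
    unfolding q_def bounded_op_diff[OF bounded_adj_W[OF that]] adj_W_sum[OF that] by simp
  ultimately have "q \<in> ?S"
    using sub[of "[]"] by auto
  then have "cinner x q = 0"
    using orthocompD Suc.prems(2) by blast
  \<comment> \<open>Every \<open>adj (W s)\<close> annihilates \<open>q\<close>, so the subtracted
    sum is orthogonal to \<open>q\<close> and \<open>cinner q q\<close> equals
    \<open>cinner x q\<close>.\<close>
  then have "cinner q q = 0"
    unfolding q_def[THEN arg_cong[of _ _ "\<lambda>u. cinner u q"]]
    by (simp add: cinner_diff cinner_sum_left cinner_adj[OF bounded_W] adj_q)
  then have q: "(\<Sum>s=1..n. W s (adj (W s) x)) = x"
    by (simp add: q_def)
  have "P p (adj (W s) x) = adj (W s) x" if s: "s \<in> {1..n}" for s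
  proof (rule Suc.IH)
    show "adj (W s) x \<in> M"
      using red s Suc.prems(1) by (auto dest: reducingD)
    show "adj (W s) x \<in> orthocomp ?S"
    proof (rule orthocomp_osumI)
      fix \<alpha> y assume \<alpha>: "\<alpha> \<in> words n" and y: "y \<in> word_op W \<alpha> ` (wandering \<inter> M)"
      then have "W s y \<in> word_op W (s # \<alpha>) ` (wandering \<inter> M)"
        by auto
      then have "W s y \<in> ?S"
        using sub[of "s # \<alpha>"] s \<alpha> by auto
      then show "cinner (adj (W s) x) y = 0"
        using orthocompD[OF Suc.prems(2)] by (simp add: cinner_adj_left[OF bounded_W[OF s]])
    qed
  qed
  then show ?case
    using q by simp
qed simp

text \<open>Applying \<open>adj (W s)\<close> to \<open>P (Suc p) x = x\<close> isolates one term of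
  the sum, namely \<open>P p (adj (W s) x)\<close>.\<close>

lemma adj_in_cuntz_part:
  assumes "x \<in> cuntz_part n W" "s \<in> {1..n}"
  shows "adj (W s) x \<in> cuntz_part n W"
proof -
  have "P p (adj (W s) x) = adj (W s) x" for p
  proof -
    have "P (Suc p) x = x"
      using assms(1) unfolding cuntz_part_eq by blast
    then show ?thesis
      using adj_W_sum[OF assms(2), of "\<lambda>t. P p (adj (W t) x)"] by simp
  qed
  then show ?thesis
    by (simp add: cuntz_part_eq)
qed

lemma cuntz_part_sum:
  assumes "x \<in> cuntz_part n W"
  shows "(\<Sum>s=1..n. W s (adj (W s) x)) = x"
proof -
  have "P (Suc 0) x = x"
    using assms unfolding cuntz_part_eq by blast
  then show ?thesis
    by simp
qed

text \<open>The first letter moves across as an adjoint, under which the Cuntz part is invariant.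
  For the empty word, \<open>x\<close> is a sum of vectors in the ranges of the \<open>W s\<close>,
  and these are orthogonal to wandering vectors.\<close>

lemma cuntz_part_orthogonal:
  assumes "x \<in> cuntz_part n W" "\<alpha> \<in> words n" "l \<in> wandering"
  shows "cinner x (word_op W \<alpha> l) = 0"
  using assms(1,2)
proof (induction \<alpha> arbitrary: x)
  case Nil
  have "cinner x l = cinner (\<Sum>s=1..n. W s (adj (W s) x)) l"
    using cuntz_part_sum[OF Nil(1)] by simp
  also have "\<dots> = 0"
    using assms(3) by (simp add: cinner_sum_left cinner_adj[OF bounded_W])
  finally show ?case
    by simp
next
  case (Cons s \<alpha>)
  then show ?case
    using adj_in_cuntz_part[of x s] by (simp add: cinner_adj_left[OF bounded_W, symmetric])
qed

lemma cuntz_part_eq_orthocomp: "cuntz_part n W = orthocomp (shift_part n W)"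
proof
  show "cuntz_part n W \<subseteq> orthocomp (shift_part n W)"
    unfolding shift_part_def
    by (auto intro!: orthocomp_osumI cuntz_part_orthogonal simp: shift_summand_def)
  show "orthocomp (shift_part n W) \<subseteq> cuntz_part n W"
    using P_fixed_if_orthogonal[of UNIV]
    by (auto simp: cuntz_part_eq shift_part_def shift_summand_def[abs_def] reducing_UNIV)
qed

lemma shift_part_eq_orthocomp: "shift_part n W = orthocomp (cuntz_part n W)"
  unfolding cuntz_part_eq_orthocomp
  by (simp add: orthocomp_orthocomp shift_part_def closed_csubspace_osum)

text \<open>Invariance under \<open>W s\<close> rests on the shift relation
  \<open>P (Suc q) (W s x) = W s (P q x)\<close>, as only the term \<open>t = s\<close>
  survives.\<close>

lemma cuntz_part_reducing:
  assumes s: "s \<in> {1..n}"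
  shows "reducing (cuntz_part n W) (W s)"
proof -
  have "W s x \<in> cuntz_part n W" if x: "x \<in> cuntz_part n W" for x
  proof -
    have "P p (W s x) = W s x" for p
    proof (cases p)
      case (Suc q)
      have "P q x = x"
        using x by (simp add: cuntz_part_eq)
      have "P p (W s x) = (\<Sum>t=1..n. if t = s then W s (P q x) else 0)"
        unfolding Suc range_proj.simps
        by (rule sum.cong) (use s in \<open>auto simp: adj_W_W bounded_op_zero bounded_W bounded_P\<close>)
      then show ?thesis
        using s \<open>P q x = x\<close> by simp
    qed simp
    then show ?thesis
      by (simp add: cuntz_part_eq)
  qed
  then show ?thesis
    using s adj_in_cuntz_part closed_csubspace_cuntz_part by (auto simp: reducing_def)
qed

text \<open>Moving \<open>T\<close> past \<open>adj (W s)\<close> and \<open>W s\<close> costs the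
  factors \<open>d s\<close> and \<open>c s\<close>, which cancel within each term. Hence
  commutation up to scalars depending on the letter is enough, as is the case for the operators of
  another row.\<close>

lemma P_commute:
  assumes "\<And>x y. T (x + y) = T x + T y" "\<And>c x. T (c *\<^sub>C x) = c *\<^sub>C T x"
    and "\<And>s x. s \<in> {1..n} \<Longrightarrow> W s (T x) = c s *\<^sub>C T (W s x)"
    and "\<And>s x. s \<in> {1..n} \<Longrightarrow> adj (W s) (T x) = d s *\<^sub>C T (adj (W s) x)"
    and "\<And>s. s \<in> {1..n} \<Longrightarrow> d s * c s = 1"
  shows "P p (T x) = T (P p x)"
proof (induction p arbitrary: x)
  case (Suc p)
  have T_sum: "T (sum f A) = (\<Sum>i\<in>A. T (f i))" for f :: "nat \<Rightarrow> 'a" and A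
    using assms(2)[of 0 0] by (induction A rule: infinite_finite_induct) (auto simp: assms(1))
  have "W s (P p (adj (W s) (T x))) = T (W s (P p (adj (W s) x)))" if s: "s \<in> {1..n}" for s
    using s by (simp add: assms(3,4) Suc bounded_opD(2)[OF bounded_P] bounded_opD(2)[OF bounded_W]
        scaleC_scaleC assms(5))
  then show ?case
    by (simp add: T_sum)
qed simp

section \<open>Restrictions of the row to reducing subspaces\<close>

lemma row_isometry_on_reducing:
  assumes red: "\<forall>s\<in>{1..n}. reducing M (W s)" and M: "closed_csubspace M"
  shows "row_isometry_on M n W"
proof -
  have "adj_on M (W s) (W t x) = adj (W s) (W t x)"
    if "s \<in> {1..n}" "t \<in> {1..n}" "x \<in> M" for s t x
    using that red reducingD(2) by (blast intro: adj_on_reducing bounded_W)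
  then show ?thesis
    unfolding row_isometry_on_def
    using red M bounded_op_on_reducing(1)[OF bounded_W] by (simp add: adj_W_W)
qed

text \<open>The Cuntz identity on \<open>M\<close> can be iterated because
  \<open>adj (W s) x\<close> stays in \<open>M\<close>, so all \<open>P p\<close> fix
  \<open>x\<close>. Together with \<open>pure_on_iff\<close> it turns the conditions on the summands
  into inclusions, for existence and uniqueness alike.\<close>

lemma cuntz_on_iff:
  assumes red: "\<forall>s\<in>{1..n}. reducing M (W s)" and M: "closed_csubspace M"
  shows "cuntz_on M n W \<longleftrightarrow> M \<subseteq> cuntz_part n W"
proof
  assume "M \<subseteq> cuntz_part n W"
  then show "cuntz_on M n W"
    unfolding cuntz_on_def using row_isometry_on_reducing[OF assms] cuntz_part_sum red
    by (auto simp: adj_on_reducing[OF bounded_W])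
next
  assume "cuntz_on M n W"
  then have sum: "(\<Sum>s=1..n. W s (adj (W s) x)) = x" if "x \<in> M" for x
    using that red by (auto simp: cuntz_on_def adj_on_reducing[OF bounded_W])
  have "P p x = x" if "x \<in> M" for p x
    using that
  proof (induction p arbitrary: x)
    case (Suc p)
    then have "P p (adj (W s) x) = adj (W s) x" if "s \<in> {1..n}" for s
      using red that reducingD(3) by blast
    then show ?case
      using sum[OF Suc.prems] by simp
  qed simp
  then show "M \<subseteq> cuntz_part n W"
    by (auto simp: cuntz_part_eq)
qed

text \<open>A subspace generating a pure restriction must consist of wandering vectors; conversely
  \<open>wandering \<inter> M\<close> generates any reducing \<open>M\<close> inside the shift
  part.\<close>

lemma pure_on_iff:
  assumes red: "\<forall>s\<in>{1..n}. reducing M (W s)" and M: "closed_csubspace M"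
  shows "pure_on M n W \<longleftrightarrow> M \<subseteq> shift_part n W"
proof
  assume sub: "M \<subseteq> shift_part n W"
  let ?L = "wandering \<inter> M" and ?S = "osum (words n) (\<lambda>\<alpha>. word_op W \<alpha> ` (wandering \<inter> M))"
  have L: "closed_csubspace ?L"
    using closed_csubspace_wandering M by (rule closed_csubspace_Int)
  have S_M: "?S \<subseteq> M"
    using M word_op_in_reducing[OF red] by (intro osum_least) auto
  have "M \<subseteq> ?S"
  proof
    fix x assume "x \<in> M"
    obtain y z where yz: "x = y + z" "y \<in> ?S" "z \<in> orthocomp ?S"
      using projection_exists[OF closed_csubspace_osum] by blast
    then have "z = x - y" "y \<in> M"
      using S_M by auto
    then have z: "z \<in> M"
      using closed_csubspaceD(4)[OF M] \<open>x \<in> M\<close> by blast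
    \<comment> \<open>The part of \<open>x\<close> missed by \<open>?S\<close> is fixed by every
      \<open>P p\<close>. Being in \<open>M\<close>, it is also in the shift part, so it is
      orthogonal to itself.\<close>
    then have "z \<in> cuntz_part n W"
      using P_fixed_if_orthogonal[OF red M z yz(3)] by (simp add: cuntz_part_eq)
    then have "z = 0"
      using z sub orthocomp_Int_eq_0 unfolding shift_part_eq_orthocomp by blast
    then show "x \<in> ?S"
      using yz by simp
  qed
  moreover have "corthogonal ?L (word_op W \<alpha> ` ?L)" if "\<alpha> \<in> words n" "length \<alpha> \<ge> 1" for \<alpha>
  proof -
    have "cinner x (word_op W \<alpha> y) = 0" if "x \<in> ?L" "y \<in> ?L" for x y
    proof -
      have "[] \<noteq> \<alpha>"
        using \<open>length \<alpha> \<ge> 1\<close> by auto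
      then show ?thesis
        using cinner_wandering[of "[]" \<alpha> x y] that \<open>\<alpha> \<in> words n\<close> by simp
    qed
    then show ?thesis
      by (auto simp: corthogonal_def)
  qed
  moreover have "orthogonal_summands (words n) (\<lambda>\<alpha>. word_op W \<alpha> ` ?L)"
    by (rule orthogonal_summands_wandering[OF L]) simp
  ultimately show "pure_on M n W"
    unfolding pure_on_def using row_isometry_on_reducing[OF assms] L S_M
    by (intro conjI exI[of _ ?L] ballI impI equalityI) auto
next
  assume "pure_on M n W"
  then obtain L where "L \<subseteq> M"
    and wand: "\<And>\<alpha>. \<alpha> \<in> words n \<Longrightarrow> length \<alpha> \<ge> 1 \<Longrightarrow> corthogonal L (word_op W \<alpha> ` L)"
    and M_eq: "M = osum (words n) (\<lambda>\<alpha>. word_op W \<alpha> ` L)"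
    unfolding pure_on_def by blast
  \<comment> \<open>\<open>W s\<close> carries each word image of \<open>L\<close> to the image
    under a nonempty word, which is orthogonal to \<open>L\<close>. So \<open>adj (W s) l\<close> is
    orthogonal to all of \<open>M\<close>, to which it belongs because \<open>M\<close> is
    reducing.\<close>
  have "adj (W s) l = 0" if s: "s \<in> {1..n}" and l: "l \<in> L" for s l
  proof -
    have "adj (W s) l \<in> orthocomp (osum (words n) (\<lambda>\<alpha>. word_op W \<alpha> ` L))"
    proof (rule orthocomp_osumI)
      fix \<alpha> y assume "\<alpha> \<in> words n" "y \<in> word_op W \<alpha> ` L"
      then have "W s y \<in> word_op W (s # \<alpha>) ` L" "s # \<alpha> \<in> words n"
        using s by auto
      then show "cinner (adj (W s) l) y = 0"
        using wand[of "s # \<alpha>"] l by (auto simp: corthogonal_def cinner_adj_left[OF bounded_W[OF s]])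
    qed
    moreover have "adj (W s) l \<in> M"
      using red s l \<open>L \<subseteq> M\<close> reducingD(3) by blast
    ultimately show ?thesis
      using orthocomp_Int_eq_0 unfolding M_eq[symmetric] by blast
  qed
  then have "L \<subseteq> wandering"
    by auto
  then have "word_op W \<alpha> ` L \<subseteq> shift_part n W" if "\<alpha> \<in> words n" for \<alpha>
    using osum_superset[OF that, of "shift_summand n W"]
    unfolding shift_part_def shift_summand_def by blast
  then show "M \<subseteq> shift_part n W"
    unfolding M_eq by (intro osum_least) (simp_all add: shift_part_def closed_csubspace_osum)
qed

text \<open>As \<open>P p\<close> is self-adjoint, taking adjoints shows that it commutes with
  \<open>adj T\<close> as well; both operators then preserve its fixed points.\<close>

lemma cuntz_part_reducing_commuting:
  assumes T: "bounded_op_on UNIV T" and comm: "\<And>p x. P p (T x) = T (P p x)"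
  shows "reducing (cuntz_part n W) T"
proof -
  have "P p (adj T x) = adj T (P p x)" for p x
  proof -
    let ?d = "P p (adj T x) - adj T (P p x)"
    have "cinner ?d y = 0" for y
      by (simp add: cinner_diff P_selfadjoint cinner_adj_left[OF T] comm)
    then have "cinner ?d ?d = 0" .
    then show ?thesis
      by simp
  qed
  then show ?thesis
    using comm closed_csubspace_cuntz_part by (auto simp: reducing_def cuntz_part_eq)
qed

text \<open>\<open>P p\<close> preserves \<open>N\<close> and its complement, so
  \<open>P p y - y = z - P p z\<close> lies in both and vanishes. This is the form in which
  commutation of the projections onto \<open>N\<close> and onto the Cuntz part is used.\<close>

lemma component_in_cuntz_part:
  assumes red: "\<forall>s\<in>{1..n}. reducing N (W s)" and N: "closed_csubspace N"
    and yz: "y + z \<in> cuntz_part n W" "y \<in> N" "z \<in> orthocomp N"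
  shows "y \<in> cuntz_part n W"
proof -
  have red': "\<forall>s\<in>{1..n}. reducing (orthocomp N) (W s)"
    using red by (auto intro: reducing_orthocomp bounded_W)
  have "P p y = y" for p
  proof -
    have "P p y + P p z = y + z"
      using yz(1) by (simp add: cuntz_part_eq bounded_opD(1)[OF bounded_P, symmetric])
    then have eq: "P p y - y = z - P p z"
      by (simp add: algebra_simps)
    have "P p y - y \<in> N"
      using P_in_reducing[OF red N yz(2)] yz(2) closed_csubspaceD(4)[OF N] by simp
    moreover have "P p y - y \<in> orthocomp N"
      unfolding eq using P_in_reducing[OF red' closed_csubspace_orthocomp yz(3)] yz(3)
      by (intro closed_csubspaceD(4)[OF closed_csubspace_orthocomp])
    ultimately show ?thesis
      using orthocomp_Int_eq_0[of "P p y - y" N] by simp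
  qed
  then show ?thesis
    by (simp add: cuntz_part_eq)
qed

end

section \<open>Several commuting decompositions\<close>

text \<open>The projection onto \<open>N\<close> is self-adjoint, so if it maps \<open>M\<close>
  into itself, it also maps the complement of \<open>M\<close> into itself.\<close>

lemma component_in_orthocomp:
  fixes M N :: "'a::chilbert_space set"
  assumes N: "closed_csubspace N" and M: "closed_csubspace M"
    and comp: "\<And>y z. y + z \<in> M \<Longrightarrow> y \<in> N \<Longrightarrow> z \<in> orthocomp N \<Longrightarrow> y \<in> M"
    and yz: "y + z \<in> orthocomp M" "y \<in> N" "z \<in> orthocomp N"
  shows "y \<in> orthocomp M"
  unfolding orthocomp_def
proof (intro CollectI ballI)
  fix c assume "c \<in> M"
  obtain c1 c2 where c: "c = c1 + c2" "c1 \<in> N" "c2 \<in> orthocomp N"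
    using projection_exists[OF N] by blast
  then have "c1 \<in> M"
    using comp \<open>c \<in> M\<close> by blast
  then have "cinner (y + z) c1 = 0" "cinner z c1 = 0" "cinner y c2 = 0"
    using orthocompD[OF yz(1)] orthocompD[OF yz(3) c(2)] orthocompD[OF c(3) yz(2)] by auto
  then show "cinner y c = 0"
    by (simp add: c(1) cinner_add_left cinner_add_right)
qed

text \<open>\<open>A\<close> collects the indices on the shift side: when \<open>C i\<close> is a
  Cuntz part, its complement is the shift part. Arbitrary sets \<open>C i\<close> keep the splitting
  argument free of operators.\<close>

definition joint_part :: "('i \<Rightarrow> 'a::complex_inner set) \<Rightarrow> 'i set \<Rightarrow> 'i set \<Rightarrow> 'a set"
  where "joint_part C I A = (\<Inter>i\<in>A. orthocomp (C i)) \<inter> (\<Inter>i\<in>I - A. C i)"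

lemma joint_part_orthogonal:
  assumes "A \<subseteq> I" "B \<subseteq> I" "A \<noteq> B" "x \<in> joint_part C I A" "y \<in> joint_part C I B"
  shows "cinner x y = 0"
proof -
  from assms(1-3) obtain i where i: "i \<in> I" "i \<in> A \<and> i \<notin> B \<or> i \<in> B \<and> i \<notin> A"
    by blast
  then have "x \<in> orthocomp (C i) \<and> y \<in> C i \<or> x \<in> C i \<and> y \<in> orthocomp (C i)"
    using assms(4,5) by (auto simp: joint_part_def)
  then show ?thesis
    by (auto dest: orthocompD)
qed

text \<open>Each further index \<open>m\<close> splits every joint part over \<open>J\<close> along
  \<open>C m\<close> and its complement. By \<open>comp\<close> the two components keep their
  position relative to the old indices. Only finitely many splittings occur, so the span needs no
  closure.\<close>

lemma joint_parts_span:
  fixes C :: "'i \<Rightarrow> 'a::chilbert_space set"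
  assumes "finite I" and C: "\<And>i. i \<in> I \<Longrightarrow> closed_csubspace (C i)"
    and comp: "\<And>i j y z. i \<in> I \<Longrightarrow> j \<in> I \<Longrightarrow> i \<noteq> j \<Longrightarrow> y + z \<in> C j \<Longrightarrow> y \<in> C i \<Longrightarrow>
      z \<in> orthocomp (C i) \<Longrightarrow> y \<in> C j"
  shows "x \<in> cspan (\<Union>A\<in>Pow I. joint_part C I A)"
  using assms
proof (induction I arbitrary: x rule: finite_induct)
  \<comment> \<open>Both intersections are empty here, so the only joint part is the whole
    space.\<close>
  case empty
  then show ?case
    by (simp add: joint_part_def complex_vector.span_base)
next
  case (insert m J)
  let ?U = "\<Union>A\<in>Pow (insert m J). joint_part C (insert m J) A"
  have "joint_part C J A \<subseteq> cspan ?U" if A: "A \<in> Pow J" for A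
  proof
    fix x assume x: "x \<in> joint_part C J A"
    obtain y z where yz: "x = y + z" "y \<in> C m" "z \<in> orthocomp (C m)"
      using projection_exists[OF insert.prems(1)[of m]] by blast
    have in_C: "y \<in> C j \<and> z \<in> C j" if "j \<in> J" "x \<in> C j" for j
    proof -
      have "y \<in> C j"
        using insert.prems(2)[of m j y z] that yz insert.hyps by auto
      moreover have "z = x - y"
        using yz(1) by simp
      ultimately show ?thesis
        using closed_csubspaceD(4)[OF insert.prems(1)[of j]] that by simp
    qed
    have in_orth: "y \<in> orthocomp (C j) \<and> z \<in> orthocomp (C j)"
      if "j \<in> J" "x \<in> orthocomp (C j)" for j
    proof -
      have "m \<noteq> j"
        using that(1) insert.hyps by auto
      have "y \<in> orthocomp (C j)"
      proof (rule component_in_orthocomp)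
        show "closed_csubspace (C m)" "closed_csubspace (C j)"
          using insert.prems(1) that(1) by auto
        show "v \<in> C j" if "v + w \<in> C j" "v \<in> C m" "w \<in> orthocomp (C m)" for v w
          by (rule insert.prems(2)[OF _ _ \<open>m \<noteq> j\<close> that]) (use \<open>j \<in> J\<close> in auto)
        show "y + z \<in> orthocomp (C j)"
          using that(2) yz(1) by simp
      qed (use yz in auto)
      moreover have "z = x - y"
        using yz(1) by simp
      ultimately show ?thesis
        using closed_csubspaceD(4)[OF closed_csubspace_orthocomp] that by simp
    qed
    have "\<forall>j\<in>A. y \<in> orthocomp (C j) \<and> z \<in> orthocomp (C j)" "\<forall>j\<in>J - A. y \<in> C j \<and> z \<in> C j"
      using x A in_C in_orth by (auto simp: joint_part_def)
    \<comment> \<open>The component in \<open>C m\<close> keeps the index set \<open>A\<close>; the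
      one in the complement acquires \<open>m\<close>.\<close>
    then have "y \<in> joint_part C (insert m J) A" "z \<in> joint_part C (insert m J) (insert m A)"
      using yz by (auto simp: joint_part_def)
    then have "y \<in> ?U" "z \<in> ?U"
      using A by blast+
    then show "x \<in> cspan ?U"
      unfolding yz(1) by (intro complex_vector.span_add complex_vector.span_base)
  qed
  then have "cspan (\<Union>A\<in>Pow J. joint_part C J A) \<subseteq> cspan ?U"
    by (intro complex_vector.span_minimal) (auto simp: UN_subset_iff)
  moreover have "x \<in> cspan (\<Union>A\<in>Pow J. joint_part C J A)"
  proof (rule insert.IH)
    show "closed_csubspace (C i)" if "i \<in> J" for i
      using insert.prems(1) that by simp
    show "y \<in> C j"
      if "i \<in> J" "j \<in> J" "i \<noteq> j" "y + z \<in> C j" "y \<in> C i" "z \<in> orthocomp (C i)" for i j y z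
      by (rule insert.prems(2)[OF _ _ that(3-6)]) (use that(1,2) in auto)
  qed
  ultimately show ?case
    by blast
qed

text \<open>For \<open>x\<close> in \<open>K i\<close>, the component orthogonal to
  \<open>K' i\<close> is still in \<open>K i\<close>, hence orthogonal to every other
  \<open>K j\<close> and so to \<open>K' j\<close>. Orthogonal to all the \<open>K' j\<close>, which
  span, it is zero.\<close>

lemma orthogonal_decomposition_mono_eq:
  fixes K K' :: "'i \<Rightarrow> 'a::chilbert_space set"
  assumes K: "orthogonal_summands I K" and K': "orthogonal_summands I K'" "osum I K' = UNIV"
    and sub: "\<And>i. i \<in> I \<Longrightarrow> K' i \<subseteq> K i" and i: "i \<in> I"
  shows "K' i = K i"
proof
  show "K i \<subseteq> K' i"
  proof
    fix x assume x: "x \<in> K i"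
    obtain y z where yz: "x = y + z" "y \<in> K' i" "z \<in> orthocomp (K' i)"
      using projection_exists[of "K' i"] K'(1) i unfolding orthogonal_summands_def by blast
    have "closed_csubspace (K i)"
      using K i by (simp add: orthogonal_summands_def)
    moreover have "z = x - y" "y \<in> K i"
      using yz sub i by auto
    ultimately have z: "z \<in> K i"
      using x closed_csubspaceD(4) by blast
    have "z \<in> orthocomp (osum I K')"
    proof (rule orthocomp_osumI)
      fix j u assume j: "j \<in> I" and u: "u \<in> K' j"
      show "cinner z u = 0"
      proof (cases "j = i")
        case True
        then show ?thesis
          using yz(3) u orthocompD by blast
      next
        case False
        then have "corthogonal (K i) (K j)"
          using K i j by (simp add: orthogonal_summands_def)
        moreover have "u \<in> K j"
          using sub[OF j] u by blast
        ultimately show ?thesis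
          using z by (simp add: corthogonal_def)
      qed
    qed
    then have "z = 0"
      using K'(2) orthocomp_Int_eq_0 by auto
    then show "x \<in> K' i"
      using yz by simp
  qed
qed (rule sub[OF i])

section \<open>Doubly commuting row isometries\<close>

text \<open>The squared norm of \<open>S (T x) - c *\<^sub>C T (S x)\<close> expands into four
  multiples of \<open>cinner x x\<close>. The adjoint relation evaluates the mixed terms, and since
  \<open>c\<close> is unimodular the coefficients are 1, -1, -1, 1.\<close>

lemma doubly_commuting_isometries_commute:
  fixes S T :: "'a::chilbert_space \<Rightarrow> 'a"
  assumes S: "bounded_op_on UNIV S" "\<And>x. adj S (S x) = x"
    and T: "bounded_op_on UNIV T" "\<And>x. adj T (T x) = x"
    and comm: "\<And>x. adj S (T x) = cnj c *\<^sub>C T (adj S x)" and c: "c * cnj c = 1"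
  shows "S (T x) = c *\<^sub>C T (S x)"
proof -
  let ?u = "S (T x)" and ?v = "T (S x)"
  have uu: "cinner ?u ?u = cinner x x" and vv: "cinner ?v ?v = cinner x x"
    by (simp_all add: cinner_adj[OF S(1)] cinner_adj[OF T(1)] S T)
  have uv: "cinner ?u ?v = c * cinner x x"
    by (simp add: cinner_adj[OF S(1)] comm S(2) cinner_scaleC_right cinner_adj[OF T(1)] T(2))
  then have vu: "cinner ?v ?u = cnj c * cinner x x"
    by (metis cinner_commute complex_cnj_mult)
  have "cinner (?u - c *\<^sub>C ?v) (?u - c *\<^sub>C ?v)
      = cinner x x - cnj c * c * cinner x x - c * cnj c * cinner x x + c * cnj c * cinner x x"
    by (simp add: cinner_diff cinner_scaleC_left cinner_scaleC_right uu uv vu vv algebra_simps)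
  also have "\<dots> = 0"
    using c by (simp add: mult.commute)
  finally show ?thesis
    by simp
qed

theorem theorem1p7:
  fixes k :: nat and n :: "nat \<Rightarrow> nat"
    and \<Lambda> :: "nat \<Rightarrow> nat \<Rightarrow> nat \<Rightarrow> nat \<Rightarrow> complex"
    and V :: "nat \<Rightarrow> nat \<Rightarrow> 'a::chilbert_space \<Rightarrow> 'a"
  assumes "k \<ge> 1" and "\<forall>i\<in>{1..k}. n i \<ge> 1"
    and "\<forall>i\<in>{1..k}. \<forall>j\<in>{1..k}. i \<noteq> j \<longrightarrow>
          (\<forall>s\<in>{1..n i}. \<forall>t\<in>{1..n j}.
            norm (\<Lambda> i j s t) = 1 \<and> \<Lambda> j i t s = cnj (\<Lambda> i j s t))"
    and "\<forall>i\<in>{1..k}. row_isometry_on UNIV (n i) (V i)"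
    and "doubly_commuting k n \<Lambda> V"
  shows "\<exists>K :: nat set \<Rightarrow> 'a set.
    wold_decomposition k n V K \<and>
    (\<forall>K'. wold_decomposition k n V K' \<longrightarrow> (\<forall>A\<in>Pow {1..k}. K' A = K A)) \<and>
    (\<forall>i\<in>{1..k}.
      orthogonal_summands (words (n i)) (shift_summand (n i) (V i)) \<and>
      (\<forall>p. orthogonal_summands {\<alpha> \<in> words (n i). length \<alpha> = p} (cuntz_summand (V i)))) \<and>
    (\<forall>A\<in>Pow {1..k}.
      K A = (\<Inter>i\<in>A. shift_part (n i) (V i)) \<inter> (\<Inter>i\<in>{1..k} - A. cuntz_part (n i) (V i)))"
proof -
  define C where "C i = cuntz_part (n i) (V i)" for i
  define K where "K = joint_part C {1..k}"
  have row: "row_isometry (n i) (V i)" if "i \<in> {1..k}" for i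
    using assms(4) that by (simp add: row_isometry_def)
  have C_closed: "closed_csubspace (C i)" if "i \<in> {1..k}" for i
    unfolding C_def by (rule row_isometry.closed_csubspace_cuntz_part[OF row[OF that]])
  have shift: "shift_part (n i) (V i) = orthocomp (C i)" if "i \<in> {1..k}" for i
    unfolding C_def by (rule row_isometry.shift_part_eq_orthocomp[OF row[OF that]])
  have bounded: "bounded_op_on UNIV (V i s)" if "i \<in> {1..k}" "s \<in> {1..n i}" for i s
    using row_isometry.bounded_W[OF row] that by blast
  have iso: "adj (V i s) (V i s x) = x" if "i \<in> {1..k}" "s \<in> {1..n i}" for i s x
    using row_isometry.adj_W_W[OF row[OF that(1)] that(2,2)] by simp
  have unit: "\<Lambda> i j s t * cnj (\<Lambda> i j s t) = 1"
    if "i \<in> {1..k}" "j \<in> {1..k}" "i \<noteq> j" "s \<in> {1..n i}" "t \<in> {1..n j}" for i j s t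
  proof -
    have "norm (\<Lambda> i j s t) = 1"
      using assms(3) that by blast
    then show ?thesis
      using complex_norm_square[of "\<Lambda> i j s t"] by simp
  qed
  have adj_comm: "adj (V i s) (V j t x) = cnj (\<Lambda> i j s t) *\<^sub>C V j t (adj (V i s) x)"
    if "i \<in> {1..k}" "j \<in> {1..k}" "i \<noteq> j" "s \<in> {1..n i}" "t \<in> {1..n j}" for i j s t x
    using assms(5) that by (simp add: doubly_commuting_def)
  have comm: "V i s (V j t x) = \<Lambda> i j s t *\<^sub>C V j t (V i s x)"
    if "i \<in> {1..k}" "j \<in> {1..k}" "i \<noteq> j" "s \<in> {1..n i}" "t \<in> {1..n j}" for i j s t x
    by (rule doubly_commuting_isometries_commute)
      (simp_all add: bounded iso adj_comm unit that del: atLeastAtMost_iff)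
  have C_red: "reducing (C i) (V j t)"
    if i: "i \<in> {1..k}" and j: "j \<in> {1..k}" and t: "t \<in> {1..n j}" for i j t
  proof (cases "i = j")
    case True
    then show ?thesis
      unfolding C_def using row_isometry.cuntz_part_reducing[OF row] i t by blast
  next
    case False
    show ?thesis
      unfolding C_def
    \<comment> \<open>Row \<open>i\<close> supplies the range projections, and the single operator
      \<open>V j t\<close> of another row takes the role of \<open>T\<close>.\<close>
    proof (rule row_isometry.cuntz_part_reducing_commuting[OF row[OF i] bounded[OF j t]])
      show "range_proj (n i) (V i) p (V j t x) = V j t (range_proj (n i) (V i) p x)" for p x
      \<comment> \<open>The scalars are \<open>\<Lambda> i j s t\<close> for \<open>V i s\<close>
        and its conjugate for \<open>adj (V i s)\<close>; their product is 1 on the unit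
        circle.\<close>
      proof (rule row_isometry.P_commute[OF row[OF i]])
        show "cnj (\<Lambda> i j s t) * \<Lambda> i j s t = 1" if "s \<in> {1..n i}" for s
          using unit[OF i j False that t] by (simp add: mult.commute)
      qed (use bounded_opD[OF bounded[OF j t]] comm[OF i j False _ t] adj_comm[OF i j False _ t]
        in blast)+
    qed
  qed
  \<comment> \<open>\<open>C i\<close> reduces row \<open>j\<close> by \<open>C_red\<close>, so it
    can serve as \<open>N\<close> in \<open>component_in_cuntz_part\<close> for that row.\<close>
  have comp: "y \<in> C j"
    if "i \<in> {1..k}" "j \<in> {1..k}" "y + z \<in> C j" "y \<in> C i" "z \<in> orthocomp (C i)" for i j y z
    using row_isometry.component_in_cuntz_part[OF row[OF that(2)] _ C_closed[OF that(1)], of y z]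
      C_red[OF that(1,2)] that(3-5) by (simp add: C_def)
  have K_eq: "K A = (\<Inter>i\<in>A. shift_part (n i) (V i)) \<inter> (\<Inter>i\<in>{1..k} - A. cuntz_part (n i) (V i))"
    if "A \<in> Pow {1..k}" for A
  proof -
    have "(\<Inter>i\<in>A. shift_part (n i) (V i)) = (\<Inter>i\<in>A. orthocomp (C i))"
      by (rule INF_cong) (use that shift in blast)+
    then show ?thesis
      by (simp add: K_def joint_part_def C_def)
  qed
  have K_closed: "closed_csubspace (K A)" if "A \<in> Pow {1..k}" for A
    unfolding K_def joint_part_def
    by (intro closed_csubspace_Int closed_csubspace_INT closed_csubspace_orthocomp C_closed) auto
  have K_red: "reducing (K A) (V j t)"
    if "A \<in> Pow {1..k}" "j \<in> {1..k}" "t \<in> {1..n j}" for A j t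
    unfolding K_def joint_part_def
    by (intro reducing_Int reducing_INT reducing_orthocomp bounded C_red) (use that in auto)
  have pure: "pure_on M (n i) (V i) \<longleftrightarrow> M \<subseteq> orthocomp (C i)"
    and cuntz: "cuntz_on M (n i) (V i) \<longleftrightarrow> M \<subseteq> C i"
    if "i \<in> {1..k}" "closed_csubspace M" "\<forall>m\<in>{1..n i}. reducing M (V i m)" for M i
    using row_isometry.pure_on_iff[OF row[OF that(1)] that(3,2)] shift[OF that(1)]
      row_isometry.cuntz_on_iff[OF row[OF that(1)] that(3,2)] by (simp_all add: C_def)
  have K_orth: "orthogonal_summands (Pow {1..k}) K"
    unfolding orthogonal_summands_def corthogonal_def
    using K_closed joint_part_orthogonal[of _ "{1..k}" _ _ C] by (auto simp: K_def)
  have "x \<in> osum (Pow {1..k}) K" for x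
  proof -
    have "x \<in> cspan (\<Union>A\<in>Pow {1..k}. K A)"
      unfolding K_def
    proof (rule joint_parts_span[OF finite_atLeastAtMost C_closed])
      show "y \<in> C j"
        if "i \<in> {1..k}" "j \<in> {1..k}" "i \<noteq> j" "y + z \<in> C j" "y \<in> C i" "z \<in> orthocomp (C i)"
        for i j y z
        by (rule comp[OF that(1,2,4-6)])
    qed
    then show ?thesis
      unfolding osum_def by (rule subsetD[OF closure_subset])
  qed
  then have K_osum: "osum (Pow {1..k}) K = UNIV"
    by blast
  have K_pure: "pure_on (K A) (n i) (V i)" if "A \<in> Pow {1..k}" "i \<in> A" for A i
  proof -
    have "i \<in> {1..k}"
      using that by blast
    moreover have "K A \<subseteq> orthocomp (C i)"
      using that(2) by (auto simp: K_def joint_part_def)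
    ultimately show ?thesis
      using pure K_closed K_red that(1) by blast
  qed
  have K_cuntz: "cuntz_on (K A) (n i) (V i)" if "A \<in> Pow {1..k}" "i \<in> {1..k} - A" for A i
  proof -
    have "K A \<subseteq> C i"
      using that(2) by (auto simp: K_def joint_part_def)
    then show ?thesis
      using cuntz K_closed K_red that by blast
  qed
  have wold: "wold_decomposition k n V K"
    unfolding wold_decomposition_def
    by (intro conjI ballI K_orth K_osum K_red K_pure K_cuntz)
  \<comment> \<open>By \<open>orthogonal_decomposition_mono_eq\<close> it suffices to place each
    summand of the competitor inside the corresponding \<open>K B\<close>, which the equivalences
    \<open>pure\<close> and \<open>cuntz\<close> do index by index.\<close>
  have unique: "K' A = K A" if K': "wold_decomposition k n V K'" and A: "A \<in> Pow {1..k}" for K' A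
  proof (rule orthogonal_decomposition_mono_eq[OF K_orth _ _ _ A])
    show K'_orth: "orthogonal_summands (Pow {1..k}) K'" and "osum (Pow {1..k}) K' = UNIV"
      using K' by (simp_all add: wold_decomposition_def)
    fix B assume B: "B \<in> Pow {1..k}"
    have closed: "closed_csubspace (K' B)"
      using K'_orth B by (simp add: orthogonal_summands_def)
    have red: "\<forall>m\<in>{1..n i}. reducing (K' B) (V i m)" if "i \<in> {1..k}" for i
      using K' B that by (simp add: wold_decomposition_def)
    have "K' B \<subseteq> orthocomp (C i)" if "i \<in> B" for i
    proof -
      have i: "i \<in> {1..k}"
        using that B by blast
      have "pure_on (K' B) (n i) (V i)"
        using K' B that by (simp add: wold_decomposition_def)
      then show ?thesis
        using pure[OF i closed red[OF i]] by simp
    qed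
    moreover have "K' B \<subseteq> C i" if "i \<in> {1..k} - B" for i
    proof -
      have i: "i \<in> {1..k}"
        using that by blast
      have "cuntz_on (K' B) (n i) (V i)"
        using K' B that by (simp add: wold_decomposition_def)
      then show ?thesis
        using cuntz[OF i closed red[OF i]] by simp
    qed
    ultimately show "K' B \<subseteq> K B"
      unfolding K_def joint_part_def by blast
  qed
  show ?thesis
    \<comment> \<open>The two facts on orthogonal summands justify the direct sum notation in the
      formulas for the shift and Cuntz parts.\<close>
    using wold unique K_eq row_isometry.orthogonal_summands_shift[OF row]
      row_isometry.orthogonal_summands_cuntz[OF row]
    by (intro exI[of _ K] conjI allI impI ballI)
qed

end
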